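(* Let $\widehat f_n$ be the MLE of $f^0$ (defined in the context), where the plug-in estimators $\check\pi_n,\check u_{1,n},\check u_{2,n}$ are consistent for $\pi^0,u^0_1,u^0_2$, respectively. Then $$H(\widehat f_n,f^0)=o_p(1)\quad\text{as }n\to\infty .$$ Moreover, if $a_0>0$ is such that, for some $b\in\mathbb R$, $f^0(x)\le\exp(-a_0x+b)$ for all $x$, then for any $a\in(0,a_0)$ $$\int_{\mathbb R}e^{at}\,|\widehat f_n(t)-f^0(t)|\,dt=o_p(1),$$ and $$\sup_{t\in[-A,A]}e^{at}\,|\widehat f_n(t)-f^0(t)|=o_p(1)$$ on any continuity set $[-A,A]$ of $f^0$ (i.e. $f^0$ is continuous at every point of $[-A,A]$), where $A$ may be $\infty$ if $f^0$ is continuous on all of $\mathbb R$.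
   Context: $\mathcal{SC}$ is the class of concave functions $\psi:\mathbb R\to[-\infty,\infty)$ that are upper semicontinuous, proper (not identically $-\infty$), and satisfy $\psi(x)=\psi(-x)$ for all $x$; $\mathcal{SLC}=\{e^\psi:\psi\in\mathcal{SC}\}$; $\mathcal{SLC}_1=\{f\in\mathcal{SLC}:\int_{\mathbb R}f=1\}$. $X_1,\dots,X_n$ are i.i.d. with density $g^0(x)=\pi^0 f^0(x-u^0_1)+(1-\pi^0)f^0(x-u^0_2)$, where $f^0\in\mathcal{SLC}_1$, $\pi^0\in(0,1)\setminus\{1/2\}$, $u^0_1,u^0_2\in\mathbb R$, $u^0_1\neq u^0_2$. $\check\pi_n,\check u_{1,n},\check u_{2,n}$ are estimators (functions of $X_1,\dots,X_n$) of $\pi^0,u_1^0,u_2^0$ with $\check\pi_n\in(0,1)\setminus\{1/2\}$ and $\check u_{1,n}<\check u_{2,n}$; consistent means convergent in probability. The MLE: $\widehat f_n=e^{\widehat\psi_n}$, where $\widehat\psi_n$ maximizes over $\mathcal{SC}$ the criterion $$\Phi_n(\psi)=\frac1n\sum_{i=1}^n\log\big[\check\pi_n e^{\psi(X_i-\check u_{1,n})}+(1-\check\pi_n)e^{\psi(X_i-\check u_{2,n})}\big]-\int_{\mathbb R}e^{\psi(x)}dx.$$ Hellinger distance: $H(p,q)=\sqrt{\tfrac12\int(\sqrt{p(x)}-\sqrt{q(x)})^2dx}$. $o_p(1)$ means convergence to $0$ in probability. *)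

theory Defs
  imports "HOL-Probability.Probability"
begin

text \<open>Functions with values in \<open>[-\<infinity>, \<infinity>)\<close> are \<^typ>\<open>ereal\<close>-valued functions that never
  take the value \<open>\<infinity>\<close>. Concavity cannot use \<^const>\<open>concave_on\<close>, which is restricted to real-valued
  functions. In the concavity inequality no \<open>\<infinity> - \<infinity>\<close> can occur, because \<open>\<psi> < \<infinity>\<close>.\<close>

definition SC :: "(real \<Rightarrow> ereal) set" where
  "SC = {\<psi>. (\<forall>x. \<psi> x < \<infinity>)
           \<and> (\<forall>x y. \<forall>t\<in>{0<..<1}. ereal (1 - t) * \<psi> x + ereal t * \<psi> y \<le> \<psi> ((1 - t) * x + t * y))
           \<and> (\<forall>x. Limsup (at x) \<psi> \<le> \<psi> x)
           \<and> (\<exists>x. \<psi> x \<noteq> -\<infinity>)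
           \<and> (\<forall>x. \<psi> (- x) = \<psi> x)}"

text \<open>The exponential on \<open>[-\<infinity>, \<infinity>)\<close> and the logarithm on \<open>[0, \<infinity>)\<close>. The values of
  \<open>exp_ext\<close> at \<open>\<infinity>\<close> and of \<open>ln_ext\<close> at negative reals are junk and never matter.\<close>

definition exp_ext :: "ereal \<Rightarrow> real" where
  "exp_ext y = (if y = -\<infinity> then 0 else exp (real_of_ereal y))"

definition ln_ext :: "real \<Rightarrow> ereal" where
  "ln_ext r = (if r = 0 then -\<infinity> else ereal (ln r))"

definition SLC :: "(real \<Rightarrow> real) set" where
  "SLC = {\<lambda>x. exp_ext (\<psi> x) | \<psi>. \<psi> \<in> SC}"

definition SLC1 :: "(real \<Rightarrow> real) set" where
  "SLC1 = {f \<in> SLC. has_bochner_integral lborel f 1}"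

definition mixture :: "real \<Rightarrow> real \<Rightarrow> real \<Rightarrow> (real \<Rightarrow> real) \<Rightarrow> real \<Rightarrow> real" where
  "mixture p u1 u2 f x = p * f (x - u1) + (1 - p) * f (x - u2)"

text \<open>The criterion for data \<open>x 1, \<dots>, x n\<close> and parameters \<open>p\<close>, \<open>u1\<close>, \<open>u2\<close>. It takes values in
  \<open>[-\<infinity>, \<infinity>)\<close>: the sum is never \<open>\<infinity>\<close>, and the integral lies in \<open>[0, \<infinity>]\<close>. It is not assumed that
  \<open>exp \<psi>\<close> is integrable.\<close>

definition Phi :: "nat \<Rightarrow> (nat \<Rightarrow> real) \<Rightarrow> real \<Rightarrow> real \<Rightarrow> real \<Rightarrow> (real \<Rightarrow> ereal) \<Rightarrow> ereal" where
  "Phi n x p u1 u2 \<psi> =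
     ereal (1 / real n) * (\<Sum>i = 1..n. ln_ext (mixture p u1 u2 (\<lambda>y. exp_ext (\<psi> y)) (x i)))
     - enn2ereal (\<integral>\<^sup>+ y. ennreal (exp_ext (\<psi> y)) \<partial>lborel)"

definition hellinger :: "(real \<Rightarrow> real) \<Rightarrow> (real \<Rightarrow> real) \<Rightarrow> real" where
  "hellinger p q = sqrt (1/2 * (\<integral>x. (sqrt (p x) - sqrt (q x))\<^sup>2 \<partial>lborel))"

text \<open>\<open>Z n = o\<^sub>p(1)\<close> for nonnegative, possibly infinite quantities \<open>Z n\<close>. The outer measure agrees
  with the measure when the events are measurable; it is needed since a maximizer of the criterion is
  in general not unique and may be chosen in a non-measurable way.\<close>

definition op1 :: "'w measure \<Rightarrow> (nat \<Rightarrow> 'w \<Rightarrow> ennreal) \<Rightarrow> bool" where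
  "op1 M Z \<longleftrightarrow> (\<forall>\<epsilon>>0.
     (\<lambda>n. outer_measure_of M {\<omega> \<in> space M. Z n \<omega> > ennreal \<epsilon>}) \<longlonglongrightarrow> 0)"

definition consistent :: "'w measure \<Rightarrow> (nat \<Rightarrow> 'w \<Rightarrow> real) \<Rightarrow> real \<Rightarrow> bool" where
  "consistent M T \<theta> \<longleftrightarrow> op1 M (\<lambda>n \<omega>. ennreal \<bar>T n \<omega> - \<theta>\<bar>)"

text \<open>The sample \<open>X 1, \<dots>, X n\<close> as a point of the product space \<open>\<Pi>\<^sub>M i\<in>{1..n}. borel\<close>,
  on which estimators are functions.\<close>

definition sample :: "(nat \<Rightarrow> 'w \<Rightarrow> real) \<Rightarrow> nat \<Rightarrow> 'w \<Rightarrow> (nat \<Rightarrow> real)" where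
  "sample X n \<omega> = (\<lambda>i\<in>{1..n}. X i \<omega>)"

end

theory Submission
  imports Defs "HOL-Real_Asymp.Real_Asymp"
begin

text \<open>
  The maximizer is compared with one explicit competitor, and the comparison is turned directly into
  a bound on the Hellinger distance of the mixtures.

  Write \<open>g\<close> for the mixture with the plugged-in parameters and the maximizer \<open>f\<close>, and \<open>g0\<close> for the
  true mixture. The competitor is \<open>f0\<close> with its peak stretched into a plateau of half-width \<open>d\<close>. It
  stays in the class (\<open>SC_plateau\<close>), its integral is at most \<open>1 + 2 d f0(0)\<close> (\<open>plateau_integral\<close>), and
  it dominates all shifts of \<open>f0\<close> by at most \<open>d\<close>. So if the parameters are within \<open>d\<close> of the truth, the
  mixture of the competitor is at least \<open>(1 - O(d)) g0\<close>, and optimality of \<open>f\<close> shows that the average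
  of \<open>ln g\<close> over the sample is at least that of \<open>ln g0\<close> minus \<open>O(d)\<close> (\<open>basic_inequality\<close>).

  For an upper bound, the peak \<open>f 0\<close> is bounded first: a log-concave density with a high peak is tiny
  elsewhere, which costs too much likelihood (\<open>peak_bound\<close>). Then \<open>ln (g + c)\<close> is bounded and of bounded
  variation for every \<open>c > 0\<close>, uniformly in \<open>f\<close>, so its sample average and its integral against \<open>g0\<close>
  differ by at most a constant times the Kolmogorov distance between the empirical and the true law.
  The inequality \<open>ln z \<le> 2 (sqrt z - 1)\<close> converts what is left into
  \<open>\<integral> (sqrt g - sqrt g0)\<^sup>2 \<le> O(d) + 2 sqrt c \<integral> sqrt g0\<close> (\<open>likelihood_hellinger\<close>), which is small
  if \<open>c\<close> is chosen first and \<open>d\<close> afterwards. Since the two weights of the mixture differ, the mixing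
  operator is bounded below on \<open>L\<^sup>1\<close> (\<open>mixture_L1_lower\<close>), and closeness of \<open>g\<close> to \<open>g0\<close> becomes closeness
  of \<open>f\<close> to \<open>f0\<close> (\<open>maximizer_L1_close\<close>).

  All of this concerns a single sample, and the conclusion holds for every maximizer. The only random
  inputs are the consistency of the plug-in estimators and the weak law of large numbers for \<open>ln g0\<close> and
  for finitely many half-lines, so the result passes to outer probability.

  The three assertions follow from closeness in \<open>L\<^sup>1\<close>, because monotonicity and log-concavity upgrade it:
  all densities of the class that are near \<open>f0\<close> share an exponential envelope with almost the rate of
  \<open>f0\<close> (\<open>L1_exp_envelope\<close>), which gives the weighted integral, and they are uniformly close to \<open>f0\<close> on
  intervals of continuity (\<open>uniform_close\<close>), which together with the envelope gives the weighted supremum.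
\<close>

section \<open>The class of concave exponents\<close>

lemma exp_ext_ereal [simp]: "exp_ext (ereal r) = exp r"
  by (simp add: exp_ext_def)

lemma exp_ext_minf [simp]: "exp_ext (-\<infinity>) = 0"
  by (simp add: exp_ext_def)

lemma exp_ext_nonneg [simp]: "0 \<le> exp_ext y"
  by (simp add: exp_ext_def)

lemma exp_ext_add: "y < \<infinity> \<Longrightarrow> exp_ext (y + ereal c) = exp c * exp_ext y"
  by (cases y) (auto simp: exp_add)

lemma SC_D:
  assumes "\<psi> \<in> SC"
  shows SC_less_infinity: "\<psi> x < \<infinity>"
    and SC_concave: "0 < t \<Longrightarrow> t < 1 \<Longrightarrow>
          ereal (1 - t) * \<psi> x + ereal t * \<psi> y \<le> \<psi> ((1 - t) * x + t * y)"
    and SC_usc: "Limsup (at x) \<psi> \<le> \<psi> x"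
    and SC_proper: "\<exists>x. \<psi> x \<noteq> -\<infinity>"
    and SC_even: "\<psi> (- x) = \<psi> x"
  using assms by (auto simp: SC_def)

lemma SC_antimono_abs:
  assumes "\<psi> \<in> SC" and "\<bar>x\<bar> \<le> \<bar>y\<bar>"
  shows "\<psi> y \<le> \<psi> x"
proof -
  have ev: "\<psi> \<bar>z\<bar> = \<psi> z" for z
    using SC_even[OF assms(1), of z] by (simp add: abs_if)
  show ?thesis
  proof (cases "\<bar>x\<bar> = \<bar>y\<bar>")
    case True
    then show ?thesis using ev[of x] ev[of y] by simp
  next
    case False
    define t where "t = (1 + \<bar>x\<bar> / \<bar>y\<bar>) / 2"
    have y0: "\<bar>y\<bar> > 0" using False assms(2) by linarith
    have q: "\<bar>x\<bar> / \<bar>y\<bar> < 1" "0 \<le> \<bar>x\<bar> / \<bar>y\<bar>"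
      using False assms(2) y0 by (auto simp: divide_simps)
    have t: "0 < t" "t < 1"
      using q by (auto simp: t_def intro: add_pos_nonneg)
    have eq: "(1 - t) * (- \<bar>y\<bar>) + t * \<bar>y\<bar> = \<bar>x\<bar>"
      using y0 by (simp add: t_def field_simps)
    have "ereal (1 - t) * \<psi> (- \<bar>y\<bar>) + ereal t * \<psi> \<bar>y\<bar> \<le> \<psi> \<bar>x\<bar>"
      using SC_concave[OF assms(1) t, of "- \<bar>y\<bar>" "\<bar>y\<bar>"] eq by simp
    then have "ereal (1 - t) * \<psi> y + ereal t * \<psi> y \<le> \<psi> x"
      by (simp add: SC_even[OF assms(1)] ev)
    moreover have "ereal (1 - t) * \<psi> y + ereal t * \<psi> y = \<psi> y"
      using SC_less_infinity[OF assms(1), of y] t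
      by (cases "\<psi> y") (auto simp: algebra_simps)
    ultimately show ?thesis by simp
  qed
qed

lemma SC_add_const:
  assumes "\<psi> \<in> SC"
  shows "(\<lambda>x. \<psi> x + ereal c) \<in> SC"
proof -
  note D = SC_D[OF assms]
  have fin: "\<psi> x + ereal c < \<infinity>" for x
    using D(1)[of x] by (cases "\<psi> x") auto
  have conc: "ereal (1 - t) * (\<psi> x + ereal c) + ereal t * (\<psi> y + ereal c)
      \<le> \<psi> ((1 - t) * x + t * y) + ereal c" if "0 < t" "t < 1" for t x y
    using D(2)[OF that, of x y] D(1)[of x] D(1)[of y] D(1)[of "(1 - t) * x + t * y"] that
    by (cases "\<psi> x"; cases "\<psi> y"; cases "\<psi> ((1 - t) * x + t * y)")
       (auto simp: algebra_simps)
  have usc: "Limsup (at x) (\<lambda>x. \<psi> x + ereal c) \<le> \<psi> x + ereal c" for x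
    unfolding Limsup_le_iff
  proof (intro allI impI)
    fix z assume "\<psi> x + ereal c < z"
    then have "\<psi> x < z - ereal c"
      by (cases "\<psi> x"; cases z) auto
    then have "\<forall>\<^sub>F y in at x. \<psi> y < z - ereal c"
      using D(3)[of x] unfolding Limsup_le_iff by blast
    then show "\<forall>\<^sub>F y in at x. \<psi> y + ereal c < z"
    proof eventually_elim
      case (elim y)
      then show ?case by (cases "\<psi> y"; cases z) auto
    qed
  qed
  obtain x where "\<psi> x \<noteq> -\<infinity>" using D(4) by blast
  then have "\<psi> x + ereal c \<noteq> -\<infinity>" by (cases "\<psi> x") auto
  then show ?thesis
    unfolding SC_def using fin conc usc D(5) by auto
qed

text \<open>Stretching the peak of a concave even function into a plateau of half-width \<open>d\<close> keeps it in
  the class, since \<open>x \<mapsto> max 0 (|x| - d)\<close> is convex and the function decreases in \<open>|x|\<close>. The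
  stretched function dominates every shift of the original by at most \<open>d\<close>. This is what makes it a
  competitor in the likelihood that does not lose observations at the boundary of the support.\<close>

lemma SC_plateau:
  assumes "\<psi> \<in> SC" and d: "0 \<le> d"
  shows "(\<lambda>x. \<psi> (max 0 (\<bar>x\<bar> - d))) \<in> SC"
proof -
  note D = SC_D[OF assms(1)]
  let ?m = "\<lambda>x. max 0 (\<bar>x\<bar> - d)"
  have conc: "ereal (1 - t) * \<psi> (?m x) + ereal t * \<psi> (?m y) \<le> \<psi> (?m ((1 - t) * x + t * y))"
    if t: "0 < t" "t < 1" for t x y
  proof -
    have "\<bar>(1 - t) * x + t * y\<bar> \<le> (1 - t) * \<bar>x\<bar> + t * \<bar>y\<bar>"
      using abs_triangle_ineq[of "(1 - t) * x" "t * y"] t by (simp add: abs_mult)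
    moreover have "(1 - t) * (\<bar>x\<bar> - d) \<le> (1 - t) * ?m x" "t * (\<bar>y\<bar> - d) \<le> t * ?m y"
      using t by (auto intro!: mult_left_mono)
    moreover have "0 \<le> (1 - t) * ?m x" "0 \<le> t * ?m y" using t by auto
    moreover have "(1 - t) * \<bar>x\<bar> + t * \<bar>y\<bar> - d = (1 - t) * (\<bar>x\<bar> - d) + t * (\<bar>y\<bar> - d)"
      by (simp add: algebra_simps)
    ultimately have "?m ((1 - t) * x + t * y) \<le> (1 - t) * ?m x + t * ?m y"
      by (intro max.boundedI) linarith+
    then have "\<psi> ((1 - t) * ?m x + t * ?m y) \<le> \<psi> (?m ((1 - t) * x + t * y))"
      by (intro SC_antimono_abs[OF assms(1)]) auto
    then show ?thesis using D(2)[OF t, of "?m x" "?m y"] by order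
  qed
  have usc: "Limsup (at x) (\<lambda>x. \<psi> (?m x)) \<le> \<psi> (?m x)" for x
    unfolding Limsup_le_iff
  proof (intro allI impI)
    fix z assume z: "\<psi> (?m x) < z"
    then have "\<forall>\<^sub>F y in at (?m x). \<psi> y < z"
      using D(3)[of "?m x"] unfolding Limsup_le_iff by blast
    then have ev: "\<forall>\<^sub>F y in nhds (?m x). \<psi> y < z"
      using z by (auto simp: eventually_at_filter elim: eventually_mono)
    have "filterlim ?m (nhds (?m x)) (at x)"
      by (intro tendsto_intros)
    then show "\<forall>\<^sub>F y in at x. \<psi> (?m y) < z"
      using ev by (rule eventually_compose_filterlim[rotated])
  qed
  obtain x where x: "\<psi> x \<noteq> -\<infinity>" using D(4) by blast
  have "\<psi> x \<le> \<psi> (?m 0)"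
    using d by (intro SC_antimono_abs[OF assms(1)]) auto
  then have "\<psi> (?m 0) \<noteq> -\<infinity>" using x by auto
  then have "\<exists>x. \<psi> (?m x) \<noteq> -\<infinity>" by blast
  then show ?thesis
    unfolding SC_def using D(1) conc usc by auto
qed

section \<open>Even log-concave functions\<close>

text \<open>Log-concavity is stated multiplicatively, so that zeros need no special treatment: the real
  power \<open>0 powr t\<close> is \<open>0\<close>.\<close>

definition even_logconcave :: "(real \<Rightarrow> real) \<Rightarrow> bool" where
  "even_logconcave f \<longleftrightarrow> (\<forall>x. 0 \<le> f x) \<and> (\<forall>x. f (- x) = f x) \<and>
     (\<forall>x y. \<forall>t\<in>{0<..<1}. f x powr (1 - t) * f y powr t \<le> f ((1 - t) * x + t * y))"

text \<open>The prefixes \<open>elc\<close> and \<open>elcd\<close> of names refer to even log-concave functions and densities.\<close>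

definition elc_density :: "(real \<Rightarrow> real) \<Rightarrow> bool" where
  "elc_density f \<longleftrightarrow> even_logconcave f \<and> has_bochner_integral lborel f 1"

lemma even_logconcave_exp_ext:
  assumes "\<psi> \<in> SC"
  shows "even_logconcave (\<lambda>x. exp_ext (\<psi> x))"
proof -
  note D = SC_D[OF assms]
  have "exp_ext (\<psi> x) powr (1 - t) * exp_ext (\<psi> y) powr t \<le> exp_ext (\<psi> ((1 - t) * x + t * y))"
    if "0 < t" "t < 1" for t x y
    using D(2)[OF that, of x y] D(1)[of x] D(1)[of y] D(1)[of "(1 - t) * x + t * y"] that
    by (cases "\<psi> x"; cases "\<psi> y"; cases "\<psi> ((1 - t) * x + t * y)")
       (auto simp: algebra_simps powr_def simp flip: exp_add)
  then show ?thesis unfolding even_logconcave_def using D(5) by auto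
qed

lemma even_logconcaveD:
  assumes "even_logconcave f"
  shows elc_nonneg: "0 \<le> f x" and elc_even: "f (- x) = f x" and elc_abs: "f \<bar>x\<bar> = f x"
    and elc_powr: "0 < t \<Longrightarrow> t < 1 \<Longrightarrow> f x powr (1 - t) * f y powr t \<le> f ((1 - t) * x + t * y)"
  using assms by (auto simp: even_logconcave_def abs_if)

text \<open>If \<open>|x| \<le> |y|\<close>, then \<open>|x|\<close> lies between \<open>- |y|\<close> and \<open>|y|\<close>, where the function takes the same
  value.\<close>

lemma elc_antimono_abs:
  assumes f: "even_logconcave f" and "\<bar>x\<bar> \<le> \<bar>y\<bar>"
  shows "f y \<le> f x"
proof (cases "\<bar>x\<bar> = \<bar>y\<bar> \<or> f y = 0")
  case True
  then show ?thesis using elc_abs[OF f, of x] elc_abs[OF f, of y] elc_nonneg[OF f, of x] by auto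
next
  case False
  define t where "t = (1 + \<bar>x\<bar> / \<bar>y\<bar>) / 2"
  have y0: "\<bar>y\<bar> > 0" using False assms(2) by linarith
  have "\<bar>x\<bar> / \<bar>y\<bar> < 1" "0 \<le> \<bar>x\<bar> / \<bar>y\<bar>"
    using False assms(2) y0 by (auto simp: divide_simps)
  then have t: "0 < t" "t < 1" by (auto simp: t_def intro: add_pos_nonneg)
  have eq: "(1 - t) * (- \<bar>y\<bar>) + t * \<bar>y\<bar> = \<bar>x\<bar>"
    using y0 by (simp add: t_def field_simps)
  have "f y powr (1 - t) * f y powr t \<le> f x"
    using elc_powr[OF f t, of "- \<bar>y\<bar>" "\<bar>y\<bar>"] unfolding eq
    by (simp only: elc_abs[OF f] elc_even[OF f])
  then show ?thesis
    using False elc_nonneg[OF f, of y] by (simp flip: powr_add)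
qed

lemma elc_le_0: "even_logconcave f \<Longrightarrow> f x \<le> f 0"
  by (rule elc_antimono_abs) auto

lemma elc_measurable:
  assumes f: "even_logconcave f"
  shows "f \<in> borel_measurable borel"
proof -
  have "mono (\<lambda>x. - f (max x 0))"
    by (intro monoI le_imp_neg_le elc_antimono_abs[OF f]) auto
  then have "(\<lambda>x. - f (max x 0)) \<in> borel_measurable borel"
    by (rule borel_measurable_mono)
  then have "(\<lambda>x. - f (max \<bar>x\<bar> 0)) \<in> borel_measurable borel"
    by (rule measurable_compose[rotated]) simp
  then have "(\<lambda>x. - (- f (max \<bar>x\<bar> 0))) \<in> borel_measurable borel"
    by (rule borel_measurable_uminus)
  then show ?thesis using elc_abs[OF f] by (simp add: max_absorb1)
qed

lemma elc_midpoint: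
  assumes f: "even_logconcave f"
  shows "f 0 * f (2 * h) \<le> (f h)\<^sup>2"
proof -
  have "sqrt (f 0) * sqrt (f (2 * h)) \<le> f h"
    using elc_powr[OF f, of "1/2" 0 "2 * h"] elc_nonneg[OF f] by (simp add: powr_half_sqrt)
  then have "(sqrt (f 0) * sqrt (f (2 * h)))\<^sup>2 \<le> (f h)\<^sup>2"
    using elc_nonneg[OF f] by (intro power_mono) auto
  then show ?thesis using elc_nonneg[OF f] by (simp add: power_mult_distrib)
qed

text \<open>A concave function lies below the extension of any of its chords; here the chord of \<open>ln f\<close>
  from \<open>0\<close> to \<open>y\<close>, whose slope is at most \<open>-a\<close>.\<close>

lemma elc_exp_tail:
  assumes f: "even_logconcave f" and y: "0 < y" and le: "f y \<le> f 0 * exp (- a * y)" and "y \<le> x"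
  shows "f x \<le> f 0 * exp (- a * x)"
proof (rule ccontr)
  assume n: "\<not> ?thesis"
  then have "y \<noteq> x" using le by auto
  then have x: "y < x" using \<open>y \<le> x\<close> by simp
  define t where "t = y / x"
  have t: "0 < t" "t < 1" using y x by (auto simp: t_def)
  have f0: "0 < f 0"
    using n elc_le_0[OF f, of x] elc_nonneg[OF f, of 0] by (cases "f 0 = 0") auto
  have ty: "(1 - t) * 0 + t * x = y" using x y by (simp add: t_def)
  have "f 0 * exp (- a * y) = f 0 powr (1 - t) * (f 0 * exp (- a * x)) powr t"
    using f0 x y by (simp add: powr_mult flip: powr_add mult.assoc) (simp add: powr_def t_def)
  also have "\<dots> < f 0 powr (1 - t) * f x powr t"
    using n f0 t by (intro mult_strict_left_mono powr_less_mono2) auto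
  also have "\<dots> \<le> f y" using elc_powr[OF f t, of 0 x] ty by simp
  finally show False using le by simp
qed

lemma elc_densityD:
  assumes "elc_density f"
  shows elcd_elc: "even_logconcave f" and elcd_integrable: "integrable lborel f"
    and elcd_integral: "integral\<^sup>L lborel f = 1"
  using assms by (auto simp: elc_density_def has_bochner_integral_iff)

lemma elcd_measurable [measurable_dest]: "elc_density f \<Longrightarrow> f \<in> borel_measurable borel"
  by (intro elc_measurable elcd_elc)

lemma elcd_le:
  assumes f: "elc_density f" and x: "0 < x"
  shows "f x \<le> 1 / (2 * x)"
proof -
  note e = elcd_elc[OF f]
  have "(\<integral>y. indicator {-x..x} y * f x \<partial>lborel) \<le> integral\<^sup>L lborel f"
  proof (rule integral_mono)
    show "integrable lborel (\<lambda>y. indicator {-x..x} y * f x)"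
      by (intro integrable_mult_left integrable_real_indicator) (auto simp: emeasure_lborel_Icc_eq)
  qed (use elcd_integrable[OF f] elc_nonneg[OF e] in
        \<open>auto simp: indicator_def intro!: elc_antimono_abs[OF e]\<close>)
  then have "2 * x * f x \<le> 1" using x elcd_integral[OF f] by simp
  then show ?thesis using x by (simp add: field_simps)
qed

lemma elcd_pos_at:
  assumes f: "elc_density f"
  shows "\<exists>h>0. 0 < f h"
proof (rule ccontr)
  assume n: "\<not> ?thesis"
  note e = elcd_elc[OF f]
  have "f x = 0" if "x \<noteq> 0" for x
    using n that elc_nonneg[OF e, of "\<bar>x\<bar>"] elc_abs[OF e, of x]
    by (metis less_eq_real_def zero_less_abs_iff)
  then have "AE x in lborel. f x = 0"
    using AE_lborel_singleton[of 0] by auto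
  then have "integral\<^sup>L lborel f = 0"
    by (rule integral_eq_zero_AE)
  then show False using elcd_integral[OF f] by simp
qed

lemma elcd_pos_0: "elc_density f \<Longrightarrow> 0 < f 0"
  using elcd_pos_at[of f] elc_le_0[OF elcd_elc, of f] by (meson less_le_trans)

text \<open>Since \<open>f y \<le> 1 / (2 y)\<close>, the value at \<open>1 / f 0\<close> is at most half the peak. So the chord of the
  logarithm from \<open>0\<close> to there has negative slope.\<close>

lemma elcd_exp_bound:
  assumes f: "elc_density f"
  obtains a B where "0 < a" "0 < B" "\<And>x. f x \<le> B * exp (- a * \<bar>x\<bar>)"
proof -
  note e = elcd_elc[OF f]
  have f0: "0 < f 0" by (rule elcd_pos_0[OF f])
  define y where "y = 1 / f 0"
  define a where "a = ln 2 * f 0"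
  have y: "0 < y" and a: "0 < a" using f0 by (auto simp: y_def a_def)
  have "f y \<le> f 0 * exp (- a * y)"
    using elcd_le[OF f y] f0 by (simp add: y_def a_def exp_minus)
  note tail = elc_exp_tail[OF e y this]
  have "f x \<le> f 0 * exp (a * y) * exp (- a * \<bar>x\<bar>)" for x
  proof (cases "y \<le> \<bar>x\<bar>")
    case True
    have "f x \<le> f 0 * exp (- a * \<bar>x\<bar>)" using tail[OF True] elc_abs[OF e] by simp
    also have "\<dots> \<le> f 0 * exp (a * y) * exp (- a * \<bar>x\<bar>)"
      using a y f0 by simp
    finally show ?thesis .
  next
    case False
    have "f x \<le> f 0 * 1" using elc_le_0[OF e] by simp
    also have "\<dots> \<le> f 0 * (exp (a * y) * exp (- a * \<bar>x\<bar>))"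
      using False f0 a by (intro mult_left_mono) (auto simp flip: exp_add)
    finally show ?thesis by (simp add: mult.assoc)
  qed
  then show ?thesis using that[OF a, of "f 0 * exp (a * y)"] f0 by simp
qed

lemma exp_abs_integrable:
  assumes "0 < (a::real)"
  shows "integrable lborel (\<lambda>x. exp (- a * \<bar>x\<bar>))"
proof -
  have "(\<integral>\<^sup>+x. ennreal (exponential_density a x) \<partial>lborel) = 1"
    using prob_space.emeasure_space_1[OF prob_space_exponential_density[OF assms]]
    by (simp add: emeasure_density)
  then have "integrable lborel (exponential_density a)"
    using exponential_density_nonneg[OF assms] by (intro integrableI_nonneg) auto
  then have i: "integrable lborel (\<lambda>x. exponential_density a x / a)"
    by simp
  then have "integrable lborel (\<lambda>x. exponential_density a (0 + (-1) * x) / a)"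
    by (intro lborel_integrable_real_affine) auto
  with i have "integrable lborel (\<lambda>x. exponential_density a x / a + exponential_density a (0 + (-1) * x) / a)"
    by (rule Bochner_Integration.integrable_add)
  then show ?thesis
    by (rule Bochner_Integration.integrable_bound) (use assms in \<open>auto simp: exponential_density_def abs_if mult.commute\<close>)
qed

lemma elcd_sqrt_integrable:
  assumes f: "elc_density f"
  shows "integrable lborel (\<lambda>x. sqrt (f x))"
proof -
  obtain a B where a: "0 < a" "0 < B" and b: "\<And>x. f x \<le> B * exp (- a * \<bar>x\<bar>)"
    using elcd_exp_bound[OF f] by blast
  note [measurable] = elcd_measurable[OF f]
  have bd: "sqrt (f x) \<le> sqrt B * exp (- (a/2) * \<bar>x\<bar>)" for x
  proof -
    have "sqrt (f x) \<le> sqrt (B * exp (- a * \<bar>x\<bar>))" using b by simp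
    also have "B * exp (- a * \<bar>x\<bar>) = B * (exp (- (a/2) * \<bar>x\<bar>))\<^sup>2"
      by (simp add: power2_eq_square flip: exp_add)
    finally show ?thesis by (simp add: real_sqrt_mult)
  qed
  have "integrable lborel (\<lambda>x. sqrt B * exp (- (a/2) * \<bar>x\<bar>))"
    using exp_abs_integrable[of "a/2"] a by simp
  then show ?thesis
    by (rule Bochner_Integration.integrable_bound) (use bd elc_nonneg[OF elcd_elc[OF f]] a in auto)
qed

section \<open>Two-component location mixtures\<close>

lemma elcd_shift:
  assumes f: "elc_density f"
  shows shift_integrable: "integrable lborel (\<lambda>x. f (x - u))"
    and shift_integral: "(\<integral>x. f (x - u) \<partial>lborel) = 1"
proof -
  show "integrable lborel (\<lambda>x. f (x - u))"
    using lborel_integrable_real_affine[OF elcd_integrable[OF f], of 1 "-u"] by simp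
  show "(\<integral>x. f (x - u) \<partial>lborel) = 1"
    using lborel_integral_real_affine[of 1 f "-u"] elcd_integral[OF f] by simp
qed

lemma integral_shift: "(\<integral>x. h (x - u) \<partial>lborel) = (\<integral>x. h x \<partial>lborel)" for h :: "real \<Rightarrow> real"
  using lborel_integral_real_affine[of 1 h "-u"] by simp

lemma integrable_shift:
  "integrable lborel h \<Longrightarrow> integrable lborel (\<lambda>x. h (x - u))" for h :: "real \<Rightarrow> real"
  using lborel_integrable_real_affine[of h 1 "-u"] by simp

lemma mixture_basic:
  assumes f: "elc_density f" and p: "0 \<le> p" "p \<le> 1"
  shows mixture_measurable: "mixture p u1 u2 f \<in> borel_measurable borel"
    and mixture_nonneg: "0 \<le> mixture p u1 u2 f x"
    and mixture_le: "mixture p u1 u2 f x \<le> f 0"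
    and mixture_integrable: "integrable lborel (mixture p u1 u2 f)"
    and mixture_integral: "integral\<^sup>L lborel (mixture p u1 u2 f) = 1"
    and mixture_sqrt_integrable: "integrable lborel (\<lambda>x. sqrt (mixture p u1 u2 f x))"
proof -
  note e = elcd_elc[OF f]
  note n = elc_nonneg[OF e]
  have eq: "mixture p u1 u2 f = (\<lambda>x. p * f (x - u1) + (1 - p) * f (x - u2))"
    by (simp add: fun_eq_iff mixture_def)
  have [measurable]: "f \<in> borel_measurable borel" by (rule elc_measurable[OF e])
  show m: "mixture p u1 u2 f \<in> borel_measurable borel" unfolding eq by measurable
  show nn: "0 \<le> mixture p u1 u2 f x" for x unfolding eq using n p by simp
  have "p * f (x - u1) + (1 - p) * f (x - u2) \<le> p * f 0 + (1 - p) * f 0"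
    using p elc_le_0[OF e] by (intro add_mono mult_left_mono) auto
  then show "mixture p u1 u2 f x \<le> f 0" by (simp add: eq algebra_simps)
  show "integrable lborel (mixture p u1 u2 f)"
    unfolding eq using shift_integrable[OF f] by simp
  show "integral\<^sup>L lborel (mixture p u1 u2 f) = 1"
    unfolding eq using shift_integrable[OF f] shift_integral[OF f] by simp
  have "sqrt (mixture p u1 u2 f x) \<le> sqrt (f (x - u1)) + sqrt (f (x - u2))" for x
  proof -
    have "p * f (x - u1) \<le> f (x - u1)" "(1 - p) * f (x - u2) \<le> f (x - u2)"
      using p n by (auto intro: mult_left_le_one_le)
    then have "sqrt (mixture p u1 u2 f x) \<le> sqrt (f (x - u1) + f (x - u2))"
      unfolding eq by (simp add: add_mono)
    also have "\<dots> \<le> sqrt (f (x - u1)) + sqrt (f (x - u2))"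
      using n by (intro sqrt_add_le_add_sqrt) auto
    finally show ?thesis .
  qed
  note bd = this
  have "integrable lborel (\<lambda>x. sqrt (f (x - u1)) + sqrt (f (x - u2)))"
    using integrable_shift[OF elcd_sqrt_integrable[OF f]] by simp
  then show "integrable lborel (\<lambda>x. sqrt (mixture p u1 u2 f x))"
    by (rule Bochner_Integration.integrable_bound) (use m bd nn n in auto)
qed

text \<open>The substitution \<open>y = s\<^sup>4\<close> turns \<open>- ln s \<le> 1 / s\<close> into a bound of \<open>y (ln y)\<^sup>2\<close> by a multiple of
  \<open>sqrt y\<close>. It gives a finite variance of the log-density, hence the weak law for it.\<close>

lemma mult_ln_square_le:
  fixes y :: real
  assumes y: "0 \<le> y" and K: "y \<le> K"
  shows "y * (ln y)\<^sup>2 \<le> 16 * sqrt y + K\<^sup>2 * y"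
proof -
  consider "y = 0" | "0 < y" "y \<le> 1" | "1 < y" using y by linarith
  then show ?thesis
  proof cases
    case 2
    define s where "s = sqrt (sqrt y)"
    have s: "0 < s" "s \<le> 1" using 2 by (auto simp: s_def)
    have "s ^ 4 = (s\<^sup>2)\<^sup>2" by simp
    then have y4: "y = s ^ 4" using 2 by (simp add: s_def)
    have "ln (1 / s) \<le> 1 / s - 1" using s by (intro ln_le_minus_one) auto
    then have "- ln s \<le> 1 / s" using s by (simp add: ln_div)
    moreover have "0 \<le> - ln s" using s by simp
    ultimately have "(- ln s)\<^sup>2 \<le> (1 / s)\<^sup>2" by (intro power_mono) auto
    then have l: "(ln s)\<^sup>2 \<le> 1 / s\<^sup>2" by (simp add: power_divide)
    have "y * (ln y)\<^sup>2 = 16 * s ^ 4 * (ln s)\<^sup>2"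
      using s by (simp add: y4 ln_realpow power_mult_distrib)
    also have "\<dots> \<le> 16 * s ^ 4 * (1 / s\<^sup>2)"
      using l s by (intro mult_left_mono) auto
    also have "\<dots> = 16 * s\<^sup>2" using s by (simp add: power4_eq_xxxx power2_eq_square)
    also have "s\<^sup>2 = sqrt y" using y by (simp add: s_def)
    finally show ?thesis using y by (simp add: add_increasing2)
  next
    case 3
    have "ln y \<le> K" using ln_le_minus_one[of y] 3 K by linarith
    then have "(ln y)\<^sup>2 \<le> K\<^sup>2" using 3 by (intro power_mono) auto
    then have "y * (ln y)\<^sup>2 \<le> y * K\<^sup>2" using y by (intro mult_left_mono)
    then show ?thesis using y by (simp add: add_increasing mult.commute)
  qed auto
qed

lemma mixture_entropy:
  assumes f: "elc_density f" and p: "0 \<le> p" "p \<le> 1"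
  shows mixture_ln2_integrable: "integrable lborel (\<lambda>x. mixture p u1 u2 f x * (ln (mixture p u1 u2 f x))\<^sup>2)"
    and mixture_ln_integrable: "integrable lborel (\<lambda>x. mixture p u1 u2 f x * ln (mixture p u1 u2 f x))"
proof -
  let ?g = "mixture p u1 u2 f"
  note [measurable] = mixture_measurable[OF f p]
  note n = mixture_nonneg[OF f p] and i = mixture_integrable[OF f p]
  have "integrable lborel (\<lambda>x. 16 * sqrt (?g x) + (f 0)\<^sup>2 * ?g x)"
    using mixture_sqrt_integrable[OF f p] i by simp
  then show 2: "integrable lborel (\<lambda>x. ?g x * (ln (?g x))\<^sup>2)"
    by (rule Bochner_Integration.integrable_bound)
       (use n mult_ln_square_le[OF n mixture_le[OF f p]] in \<open>auto simp: abs_mult\<close>)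
  have "\<bar>?g x * ln (?g x)\<bar> \<le> ?g x + ?g x * (ln (?g x))\<^sup>2" for x
  proof -
    have "0 \<le> (\<bar>ln (?g x)\<bar> - 1)\<^sup>2" by simp
    then have "2 * \<bar>ln (?g x)\<bar> \<le> 1 + (ln (?g x))\<^sup>2" by (simp add: power2_diff)
    then have "\<bar>ln (?g x)\<bar> \<le> 1 + (ln (?g x))\<^sup>2" by linarith
    then have "?g x * \<bar>ln (?g x)\<bar> \<le> ?g x * (1 + (ln (?g x))\<^sup>2)"
      using n by (rule mult_left_mono)
    then show ?thesis using n by (simp add: abs_mult distrib_left)
  qed
  note bd = this
  have "integrable lborel (\<lambda>x. ?g x + ?g x * (ln (?g x))\<^sup>2)"
    using 2 i by simp
  then show "integrable lborel (\<lambda>x. ?g x * ln (?g x))"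
    by (rule Bochner_Integration.integrable_bound) (use n bd in auto)
qed

text \<open>Identifiability, in quantitative form: the heavier component cannot be cancelled by the
  lighter one, so the mixing operator is bounded below on \<open>L\<^sup>1\<close> by the difference of the two
  weights. This is where \<open>p \<noteq> 1/2\<close> enters.\<close>

lemma mixture_L1_lower:
  assumes f: "elc_density f" and f': "elc_density f'" and p: "0 \<le> p" "p \<le> 1"
  shows "\<bar>2 * p - 1\<bar> * (\<integral>x. \<bar>f x - f' x\<bar> \<partial>lborel)
    \<le> (\<integral>x. \<bar>mixture p u1 u2 f x - mixture p u1 u2 f' x\<bar> \<partial>lborel)"
proof -
  let ?D = "\<lambda>x. \<bar>f x - f' x\<bar>"
  let ?m = "\<lambda>x. \<bar>mixture p u1 u2 f x - mixture p u1 u2 f' x\<bar>"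
  have iD: "integrable lborel ?D"
    using elcd_integrable[OF f] elcd_integrable[OF f'] by simp
  have im: "integrable lborel ?m"
    using mixture_integrable[OF f p] mixture_integrable[OF f' p] by simp
  have eq: "mixture p u1 u2 f x - mixture p u1 u2 f' x
      = p * (f (x - u1) - f' (x - u1)) + (1 - p) * (f (x - u2) - f' (x - u2))" for x
    by (simp add: mixture_def algebra_simps)
  have a: "\<bar>p * c\<bar> = p * \<bar>c\<bar>" "\<bar>(1 - p) * c\<bar> = (1 - p) * \<bar>c\<bar>" for c
    using p by (auto simp: abs_mult)
  have 1: "p * ?D (x - u1) - (1 - p) * ?D (x - u2) \<le> ?m x"
       and 2: "(1 - p) * ?D (x - u2) - p * ?D (x - u1) \<le> ?m x" for x
    unfolding eq a[symmetric] by linarith+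
  have "(\<integral>x. p * ?D (x - u1) - (1 - p) * ?D (x - u2) \<partial>lborel) \<le> integral\<^sup>L lborel ?m"
    using integrable_shift[OF iD] im 1 by (intro integral_mono) auto
  moreover have "(\<integral>x. (1 - p) * ?D (x - u2) - p * ?D (x - u1) \<partial>lborel) \<le> integral\<^sup>L lborel ?m"
    using integrable_shift[OF iD] im 2 by (intro integral_mono) auto
  ultimately have "p * integral\<^sup>L lborel ?D - (1 - p) * integral\<^sup>L lborel ?D \<le> integral\<^sup>L lborel ?m"
      "(1 - p) * integral\<^sup>L lborel ?D - p * integral\<^sup>L lborel ?D \<le> integral\<^sup>L lborel ?m"
    using integrable_shift[OF iD] integral_shift[of ?D] by simp_all
  then show ?thesis
    by (cases "0 \<le> 2 * p - 1") (simp_all add: algebra_simps abs_if)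
qed

text \<open>The function-level counterpart of \<open>SC_plateau\<close>.\<close>

definition plateau :: "real \<Rightarrow> (real \<Rightarrow> real) \<Rightarrow> real \<Rightarrow> real" where
  "plateau d f x = f (max 0 (\<bar>x\<bar> - d))"

lemma plateau_ge:
  assumes "even_logconcave f" and "\<bar>s\<bar> \<le> d"
  shows "f (x - s) \<le> plateau d f x"
  unfolding plateau_def using assms(2) by (intro elc_antimono_abs[OF assms(1)]) linarith

lemma plateau_integral:
  assumes f: "elc_density f" and d: "0 \<le> d"
  shows plateau_integrable: "integrable lborel (plateau d f)"
    and plateau_integral_le: "integral\<^sup>L lborel (plateau d f) \<le> 1 + 2 * d * f 0"
proof -
  note e = elcd_elc[OF f] and i = elcd_integrable[OF f]
  note n = elc_nonneg[OF e]
  have [measurable]: "f \<in> borel_measurable borel" by (rule elc_measurable[OF e])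
  define r where "r x = indicator {0<..} x * f x" for x
  define l where "l x = indicator {..<0} x * f x" for x
  define c where "c x = indicator {-d..d} x * f 0" for x
  have ir: "integrable lborel r" and il: "integrable lborel l"
    unfolding r_def l_def using i by (auto intro!: integrable_real_mult_indicator simp: mult.commute)
  have ic: "integrable lborel c"
    unfolding c_def
    by (intro integrable_mult_left integrable_real_indicator) (auto simp: emeasure_lborel_Icc_eq)
  have icv: "integral\<^sup>L lborel c = 2 * d * f 0" unfolding c_def using d by simp
  have eq: "plateau d f x = c x + (r (x - d) + l (x - (- d)))" for x
  proof -
    consider "d < x" | "x < - d" | "\<bar>x\<bar> \<le> d" by linarith
    then show ?thesis
    proof cases
      case 1
      then have "max 0 (\<bar>x\<bar> - d) = x - d" using d by simp
      then show ?thesis using 1 d by (simp add: plateau_def c_def r_def l_def)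
    next
      case 2
      then have "max 0 (\<bar>x\<bar> - d) = - (x - (- d))" using d by simp
      then have "plateau d f x = f (x - (- d))"
        unfolding plateau_def by (simp only: elc_even[OF e])
      then show ?thesis using 2 d by (simp add: c_def r_def l_def)
    next
      case 3
      then have "max 0 (\<bar>x\<bar> - d) = 0" by simp
      then show ?thesis using 3 d
        by (simp add: plateau_def c_def r_def l_def indicator_def abs_le_iff)
    qed
  qed
  show "integrable lborel (plateau d f)"
    unfolding eq by (intro Bochner_Integration.integrable_add integrable_shift ic ir il)
  have "integral\<^sup>L lborel (plateau d f) = integral\<^sup>L lborel c + (integral\<^sup>L lborel r + integral\<^sup>L lborel l)"
    unfolding eq using integrable_shift[OF ir, of d] integrable_shift[OF il, of "-d"] ic
      integral_shift[of r d] integral_shift[of l "-d"] by simp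
  also have "integral\<^sup>L lborel r + integral\<^sup>L lborel l = (\<integral>x. r x + l x \<partial>lborel)"
    using ir il by simp
  also have "\<dots> \<le> integral\<^sup>L lborel f"
    using Bochner_Integration.integrable_add[OF ir il] i n
    by (intro integral_mono) (auto simp: r_def l_def indicator_def)
  finally show "integral\<^sup>L lborel (plateau d f) \<le> 1 + 2 * d * f 0"
    using icv elcd_integral[OF f] by simp
qed

text \<open>The stretched function dominates both \<open>f\<close> and its shift, and its integral exceeds \<open>1\<close> by at
  most \<open>2 |u - v| f 0\<close>.\<close>

lemma shift_L1:
  assumes f: "elc_density f"
  shows "(\<integral>x. \<bar>f (x - u) - f (x - v)\<bar> \<partial>lborel) \<le> 4 * \<bar>u - v\<bar> * f 0"
proof -
  note e = elcd_elc[OF f]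
  let ?s = "u - v" let ?d = "\<bar>u - v\<bar>"
  have "\<bar>f (x - ?s) - f x\<bar> \<le> 2 * plateau ?d f x - f (x - ?s) - f x" for x
    using plateau_ge[OF e, of ?s ?d x] plateau_ge[OF e, of 0 ?d x] by simp
  then have "(\<integral>x. \<bar>f (x - ?s) - f x\<bar> \<partial>lborel)
      \<le> (\<integral>x. 2 * plateau ?d f x - f (x - ?s) - f x \<partial>lborel)"
    using shift_integrable[OF f] elcd_integrable[OF f] plateau_integrable[OF f, of ?d]
    by (intro integral_mono) auto
  also have "\<dots> = 2 * integral\<^sup>L lborel (plateau ?d f) - 1 - 1"
    using shift_integrable[OF f] elcd_integrable[OF f] plateau_integrable[OF f, of ?d]
      shift_integral[OF f] elcd_integral[OF f] by simp
  also have "\<dots> \<le> 4 * ?d * f 0"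
    using plateau_integral_le[OF f, of ?d] by simp
  finally show ?thesis
    using integral_shift[of "\<lambda>x. \<bar>f (x - ?s) - f x\<bar>" v] by (simp add: algebra_simps)
qed

lemma mixture_parameter_L1:
  assumes f: "elc_density f" and p: "0 \<le> p" "p \<le> 1" and p': "0 \<le> p'" "p' \<le> 1"
  shows "(\<integral>x. \<bar>mixture p u1 u2 f x - mixture p' v1 v2 f x\<bar> \<partial>lborel)
    \<le> 2 * \<bar>p - p'\<bar> + 4 * f 0 * (\<bar>u1 - v1\<bar> + \<bar>u2 - v2\<bar>)"
proof -
  note n = elc_nonneg[OF elcd_elc[OF f]]
  let ?S = "\<lambda>u v x. \<bar>f (x - u) - f (x - v)\<bar>"
  let ?R = "\<lambda>x. \<bar>p - p'\<bar> * f (x - v1) + \<bar>p - p'\<bar> * f (x - v2) + ?S u1 v1 x + ?S u2 v2 x"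
  have "\<bar>mixture p u1 u2 f x - mixture p' v1 v2 f x\<bar> \<le> ?R x" for x
  proof -
    have "mixture p u1 u2 f x - mixture p' v1 v2 f x =
        (p - p') * f (x - v1) - (p - p') * f (x - v2)
        + p * (f (x - u1) - f (x - v1)) + (1 - p) * (f (x - u2) - f (x - v2))"
      by (simp add: mixture_def algebra_simps)
    moreover have "\<bar>p * (f (x - u1) - f (x - v1))\<bar> \<le> ?S u1 v1 x"
      "\<bar>(1 - p) * (f (x - u2) - f (x - v2))\<bar> \<le> ?S u2 v2 x"
      using p by (auto simp: abs_mult intro!: mult_left_le_one_le)
    moreover have "\<bar>(p - p') * f (x - v1)\<bar> = \<bar>p - p'\<bar> * f (x - v1)"
      "\<bar>(p - p') * f (x - v2)\<bar> = \<bar>p - p'\<bar> * f (x - v2)"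
      using n by (auto simp: abs_mult)
    ultimately show ?thesis by linarith
  qed
  then have "(\<integral>x. \<bar>mixture p u1 u2 f x - mixture p' v1 v2 f x\<bar> \<partial>lborel) \<le> integral\<^sup>L lborel ?R"
    using mixture_integrable[OF f p] mixture_integrable[OF f p'] shift_integrable[OF f]
    by (intro integral_mono) auto
  also have "\<dots> = 2 * \<bar>p - p'\<bar> + integral\<^sup>L lborel (?S u1 v1) + integral\<^sup>L lborel (?S u2 v2)"
    using shift_integrable[OF f] shift_integral[OF f] by simp
  also have "\<dots> \<le> 2 * \<bar>p - p'\<bar> + 4 * f 0 * (\<bar>u1 - v1\<bar> + \<bar>u2 - v2\<bar>)"
    using shift_L1[OF f, of u1 v1] shift_L1[OF f, of u2 v2] by (simp add: algebra_simps)
  finally show ?thesis .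
qed

lemma mixture_plateau_ge:
  assumes f: "elc_density f" and p0: "0 < p0" "p0 < 1"
    and k: "k = min p0 (1 - p0)" and p: "\<bar>p - p0\<bar> \<le> d" and d: "d \<le> k"
    and u: "\<bar>u1 - v1\<bar> \<le> d" "\<bar>u2 - v2\<bar> \<le> d"
  shows "(1 - d / k) * mixture p0 v1 v2 f x \<le> mixture p u1 u2 (plateau d f) x"
proof -
  note e = elcd_elc[OF f]
  note n = elc_nonneg[OF e]
  have k0: "0 < k" and d0: "0 \<le> d" using p0 k p by auto
  have "d * k \<le> d * p0" "d * k \<le> d * (1 - p0)" using d0 k by (auto intro!: mult_left_mono)
  then have "(1 - d / k) * p0 \<le> p0 - d" "(1 - d / k) * (1 - p0) \<le> 1 - p0 - d"
    using k0 by (simp_all add: field_simps)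
  then have q: "(1 - d / k) * p0 \<le> p" "(1 - d / k) * (1 - p0) \<le> 1 - p" using p by auto
  have dk: "0 \<le> 1 - d / k" using d k0 by simp
  have p01: "0 \<le> p" "p \<le> 1" using p d k by auto
  have g: "f (x - v1) \<le> plateau d f (x - u1)" "f (x - v2) \<le> plateau d f (x - u2)"
    using plateau_ge[OF e, of "v1 - u1" d "x - u1"] plateau_ge[OF e, of "v2 - u2" d "x - u2"] u
    by (simp_all add: abs_minus_commute)
  have "(1 - d / k) * mixture p0 v1 v2 f x
      = ((1 - d / k) * p0) * f (x - v1) + ((1 - d / k) * (1 - p0)) * f (x - v2)"
    by (simp only: mixture_def distrib_left mult.assoc)
  also have "\<dots> \<le> p * plateau d f (x - u1) + (1 - p) * plateau d f (x - u2)"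
    using q g p01 n dk p0 by (intro add_mono mult_mono) auto
  finally show ?thesis by (simp add: mixture_def)
qed

section \<open>Integrals of functions of bounded variation\<close>

text \<open>A lower set of the line is empty, a half-line unbounded to the left, or the whole line, so this
  bounds the Kolmogorov distance of the two measures, for closed and for open half-lines.\<close>

definition lower_close :: "real \<Rightarrow> real measure \<Rightarrow> real measure \<Rightarrow> bool" where
  "lower_close d \<mu> \<nu> \<longleftrightarrow> (\<forall>D\<in>sets borel. (\<forall>x\<in>D. \<forall>y\<le>x. y \<in> D) \<longrightarrow> \<bar>measure \<mu> D - measure \<nu> D\<bar> \<le> d)"

lemma lower_closeD:
  "lower_close d \<mu> \<nu> \<Longrightarrow> D \<in> sets borel \<Longrightarrow> (\<And>x y. x \<in> D \<Longrightarrow> y \<le> x \<Longrightarrow> y \<in> D)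
    \<Longrightarrow> \<bar>measure \<mu> D - measure \<nu> D\<bar> \<le> d"
  unfolding lower_close_def by blast

lemma lower_close_commute: "lower_close d \<mu> \<nu> \<Longrightarrow> lower_close d \<nu> \<mu>"
  unfolding lower_close_def by (simp add: abs_minus_commute)

lemma lower_close_interval:
  assumes "prob_space \<mu>" "prob_space \<nu>" and s: "sets \<mu> = sets borel" "sets \<nu> = sets borel"
    and c: "lower_close d \<mu> \<nu>" and "a \<le> b"
  shows "measure \<mu> {a..b} \<le> measure \<nu> {a..b} + 2 * d"
proof -
  interpret \<mu>: prob_space \<mu> by fact
  interpret \<nu>: prob_space \<nu> by fact
  have eq: "{a..b} = {..b} - {..<a}" by auto
  have "measure \<mu> {a..b} = measure \<mu> {..b} - measure \<mu> {..<a}"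
    unfolding eq using \<open>a \<le> b\<close> by (intro \<mu>.finite_measure_Diff) (auto simp: s)
  moreover have "measure \<nu> {a..b} = measure \<nu> {..b} - measure \<nu> {..<a}"
    unfolding eq using \<open>a \<le> b\<close> by (intro \<nu>.finite_measure_Diff) (auto simp: s)
  moreover have "\<bar>measure \<mu> {..b} - measure \<nu> {..b}\<bar> \<le> d" by (rule lower_closeD[OF c]) auto
  moreover have "\<bar>measure \<mu> {..<a} - measure \<nu> {..<a}\<bar> \<le> d" by (rule lower_closeD[OF c]) auto
  ultimately show ?thesis by linarith
qed

lemma borel_measurable_sets_borel:
  "sets \<mu> = sets borel \<Longrightarrow> h \<in> borel_measurable borel \<Longrightarrow> h \<in> borel_measurable \<mu>"
  using measurable_cong_sets[of \<mu> borel borel borel] by blast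

text \<open>The integral of a decreasing function is an average of measures of lower sets, namely of its
  superlevel sets.\<close>

lemma nn_integral_layer_cake:
  fixes k :: "real \<Rightarrow> real"
  assumes "prob_space \<mu>" and [measurable_cong]: "sets \<mu> = sets borel"
    and [measurable]: "k \<in> borel_measurable borel" and k: "\<And>x. 0 \<le> k x" "\<And>x. k x \<le> B"
  shows "(\<integral>\<^sup>+x. ennreal (k x) \<partial>\<mu>)
    = (\<integral>\<^sup>+s. indicator {0..<B} s * emeasure \<mu> {x. s < k x} \<partial>lborel)"
proof -
  interpret prob_space \<mu> by fact
  interpret pair_sigma_finite \<mu> lborel ..
  have sp: "space \<mu> = UNIV" using sets_eq_imp_space_eq[OF assms(2)] by simp
  have [measurable]: "Measurable.pred (\<mu> \<Otimes>\<^sub>M lborel) (\<lambda>z. 0 \<le> snd z \<and> snd z < k (fst z))"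
    by measurable
  have "ennreal (k x) = (\<integral>\<^sup>+s. (if 0 \<le> s \<and> s < k x then 1 else 0) \<partial>lborel)" for x
  proof -
    have "ennreal (k x) = (\<integral>\<^sup>+s. indicator {0..<k x} s \<partial>lborel)" using k(1)[of x] by simp
    also have "\<dots> = (\<integral>\<^sup>+s. (if 0 \<le> s \<and> s < k x then 1 else 0) \<partial>lborel)"
      by (intro nn_integral_cong) (auto simp: indicator_def)
    finally show ?thesis .
  qed
  then have "(\<integral>\<^sup>+x. ennreal (k x) \<partial>\<mu>)
      = (\<integral>\<^sup>+x. \<integral>\<^sup>+s. (if 0 \<le> s \<and> s < k x then 1 else 0) \<partial>lborel \<partial>\<mu>)"
    by simp
  also have "\<dots> = (\<integral>\<^sup>+s. \<integral>\<^sup>+x. (if 0 \<le> s \<and> s < k x then 1 else 0) \<partial>\<mu> \<partial>lborel)"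
    by (intro Fubini'[symmetric]) measurable
  also have "\<dots> = (\<integral>\<^sup>+s. indicator {0..<B} s * emeasure \<mu> {x. s < k x} \<partial>lborel)"
  proof (intro nn_integral_cong)
    fix s
    have m: "{x. s < k x} \<in> sets \<mu>" using sp by measurable
    have "(\<integral>\<^sup>+x. (if 0 \<le> s \<and> s < k x then 1 else 0) \<partial>\<mu>)
        = (\<integral>\<^sup>+x. indicator {0..<B} s * indicator {x. s < k x} x \<partial>\<mu>)"
      using k(2) by (intro nn_integral_cong) (auto simp: indicator_def intro: less_le_trans)
    also have "\<dots> = indicator {0..<B} s * emeasure \<mu> {x. s < k x}"
      using m by (simp add: nn_integral_cmult)
    finally show "(\<integral>\<^sup>+x. (if 0 \<le> s \<and> s < k x then 1 else 0) \<partial>\<mu>)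
      = indicator {0..<B} s * emeasure \<mu> {x. s < k x}" .
  qed
  finally show ?thesis .
qed

lemma antimono_integral_le:
  fixes h :: "real \<Rightarrow> real"
  assumes \<mu>: "prob_space \<mu>" and \<nu>: "prob_space \<nu>"
    and s: "sets \<mu> = sets borel" "sets \<nu> = sets borel"
    and c: "lower_close d \<mu> \<nu>" and d: "0 \<le> d" and h: "antimono h" "\<And>x. a \<le> h x" "\<And>x. h x \<le> b"
  shows "integral\<^sup>L \<mu> h \<le> integral\<^sup>L \<nu> h + (b - a) * d"
proof -
  interpret \<mu>: prob_space \<mu> by fact
  interpret \<nu>: prob_space \<nu> by fact
  define k where "k x = h x - a" for x
  have k: "0 \<le> k x" "k x \<le> b - a" for x using h by (auto simp: k_def)
  have ab: "0 \<le> b - a" using k[of 0] by linarith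
  have "mono (\<lambda>x. - h x)" using h(1) by (auto simp: mono_def antimono_def)
  from borel_measurable_uminus[OF borel_measurable_mono[OF this]]
  have hm [measurable]: "h \<in> borel_measurable borel" by simp
  have [measurable]: "k \<in> borel_measurable borel" unfolding k_def by measurable
  have m: "k \<in> borel_measurable \<mu>" "k \<in> borel_measurable \<nu>"
    using borel_measurable_sets_borel[of _ k] s \<open>k \<in> borel_measurable borel\<close> by blast+
  have ik: "integrable \<mu> k" "integrable \<nu> k"
    using m k by (auto intro!: \<mu>.integrable_const_bound[of _ "b - a"] \<nu>.integrable_const_bound[of _ "b - a"])
  have le: "emeasure \<mu> {x. t < k x} \<le> emeasure \<nu> {x. t < k x} + ennreal d" for t
  proof -
    have "{x. t < k x} = {x\<in>space borel. t < k x}" by simp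
    also have "\<dots> \<in> sets borel" by measurable
    finally have "\<bar>measure \<mu> {x. t < k x} - measure \<nu> {x. t < k x}\<bar> \<le> d"
      by (rule lower_closeD[OF c]) (use antimonoD[OF h(1)] in \<open>force simp: k_def\<close>)
    then show ?thesis
      using d by (simp add: \<mu>.emeasure_eq_measure \<nu>.emeasure_eq_measure flip: ennreal_plus)
  qed
  have "ennreal (integral\<^sup>L \<mu> k) = (\<integral>\<^sup>+x. ennreal (k x) \<partial>\<mu>)"
    using ik k by (simp add: nn_integral_eq_integral)
  also have "\<dots> = (\<integral>\<^sup>+s. indicator {0..<b-a} s * emeasure \<mu> {x. s < k x} \<partial>lborel)"
    using nn_integral_layer_cake[OF \<mu> s(1) _ k] by simp
  also have "\<dots> \<le> (\<integral>\<^sup>+s. indicator {0..<b-a} s * emeasure \<nu> {x. s < k x} + ennreal d * indicator {0..<b-a} s \<partial>lborel)"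
    using le by (intro nn_integral_mono) (auto simp: indicator_def)
  also have "\<dots> = (\<integral>\<^sup>+s. indicator {0..<b-a} s * emeasure \<nu> {x. s < k x} \<partial>lborel) + ennreal d * ennreal (b - a)"
  proof -
    interpret pair_sigma_finite \<nu> lborel ..
    note [measurable_cong] = s(2)
    have "(\<lambda>s. emeasure \<nu> {x. s < k x}) \<in> borel_measurable lborel"
      using \<nu>.measurable_emeasure_Pair[of "{z \<in> space (lborel \<Otimes>\<^sub>M \<nu>). fst z < k (snd z)}" lborel]
        sets_eq_imp_space_eq[OF s(2)] by (simp add: space_pair_measure vimage_def)
    then show ?thesis
      using ab by (subst nn_integral_add) (auto simp: nn_integral_cmult)
  qed
  also have "(\<integral>\<^sup>+s. indicator {0..<b-a} s * emeasure \<nu> {x. s < k x} \<partial>lborel) = (\<integral>\<^sup>+x. ennreal (k x) \<partial>\<nu>)"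
    using nn_integral_layer_cake[OF \<nu> s(2) _ k] by simp
  also have "\<dots> = ennreal (integral\<^sup>L \<nu> k)"
    using ik k by (simp add: nn_integral_eq_integral)
  finally have "ennreal (integral\<^sup>L \<mu> k) \<le> ennreal (integral\<^sup>L \<nu> k + d * (b - a))"
    using d ab k by (simp add: ennreal_mult)
  then have "integral\<^sup>L \<mu> k \<le> integral\<^sup>L \<nu> k + d * (b - a)"
    using k d ab by (subst (asm) ennreal_le_iff) auto
  moreover have "integral\<^sup>L \<mu> h = integral\<^sup>L \<mu> k + a" "integral\<^sup>L \<nu> h = integral\<^sup>L \<nu> k + a"
  proof -
    have "h = (\<lambda>x. k x + a)" by (simp add: k_def)
    then show "integral\<^sup>L \<mu> h = integral\<^sup>L \<mu> k + a" "integral\<^sup>L \<nu> h = integral\<^sup>L \<nu> k + a"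
      using ik by (simp_all add: \<mu>.prob_space \<nu>.prob_space)
  qed
  ultimately show ?thesis by (simp add: mult.commute)
qed

text \<open>A function whose increments are controlled by those of an increasing \<open>V\<close> is the difference
  of the two decreasing functions \<open>h - V\<close> and \<open>- V\<close>.\<close>

lemma bounded_variation_integral_le:
  fixes h :: "real \<Rightarrow> real"
  assumes \<mu>: "prob_space \<mu>" and \<nu>: "prob_space \<nu>"
    and s: "sets \<mu> = sets borel" "sets \<nu> = sets borel"
    and c: "lower_close d \<mu> \<nu>" and d: "0 \<le> d"
    and [measurable]: "h \<in> borel_measurable borel"
    and h: "\<And>x. a \<le> h x" "\<And>x. h x \<le> b"
    and V: "\<And>x. 0 \<le> V x" "\<And>x. V x \<le> v" and hV: "\<And>x y. x \<le> y \<Longrightarrow> \<bar>h y - h x\<bar> \<le> V y - V x"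
  shows "integral\<^sup>L \<mu> h \<le> integral\<^sup>L \<nu> h + (b - a + 2 * v) * d"
proof -
  interpret \<mu>: prob_space \<mu> by fact
  interpret \<nu>: prob_space \<nu> by fact
  have am: "antimono (\<lambda>x. h x - V x)" "antimono (\<lambda>x. - V x)"
    using hV by (force simp: antimono_def)+
  have "mono V" using hV by (force simp: mono_def)
  then have Vm: "V \<in> borel_measurable borel" by (rule borel_measurable_mono)
  have m: "h \<in> borel_measurable \<mu>" "h \<in> borel_measurable \<nu>" "V \<in> borel_measurable \<mu>" "V \<in> borel_measurable \<nu>"
    using borel_measurable_sets_borel[of _ h] borel_measurable_sets_borel[of _ V] s Vm assms(7)
    by blast+
  have hb: "\<bar>h x\<bar> \<le> \<bar>a\<bar> + \<bar>b\<bar>" and Vb: "\<bar>V x\<bar> \<le> v" for x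
    using h[of x] V[of x] by linarith+
  have ih: "integrable \<mu> h" "integrable \<nu> h"
    using m hb by (auto intro!: \<mu>.integrable_const_bound[of _ "\<bar>a\<bar> + \<bar>b\<bar>"] \<nu>.integrable_const_bound[of _ "\<bar>a\<bar> + \<bar>b\<bar>"])
  have iV: "integrable \<mu> V" "integrable \<nu> V"
    using m Vb by (auto intro!: \<mu>.integrable_const_bound[of _ v] \<nu>.integrable_const_bound[of _ v])
  have "a - v \<le> h x - V x" "h x - V x \<le> b" for x using h[of x] V[of x] by linarith+
  from antimono_integral_le[OF \<mu> \<nu> s c d am(1) this]
  have 1: "integral\<^sup>L \<mu> h - integral\<^sup>L \<mu> V \<le> integral\<^sup>L \<nu> h - integral\<^sup>L \<nu> V + (b - a + v) * d"
    using ih iV by (simp add: algebra_simps)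
  have "- v \<le> - V x" "- V x \<le> 0" for x using V[of x] by linarith+
  from antimono_integral_le[OF \<nu> \<mu> s(2,1) lower_close_commute[OF c] d am(2) this]
  have 2: "- integral\<^sup>L \<nu> V \<le> - integral\<^sup>L \<mu> V + v * d"
    using iV by simp
  from 1 2 show ?thesis by (simp add: algebra_simps)
qed

lemma quantile_grid:
  fixes \<nu> :: "real measure"
  assumes "real_distribution \<nu>" and atomless: "\<And>x. measure \<nu> {x} = 0"
  shows "\<exists>t. \<forall>j\<in>{1..<m}. measure \<nu> {..t j} = real j / real m"
proof -
  interpret real_distribution \<nu> by fact
  have "\<exists>t. cdf \<nu> t = real j / real m" if j: "j \<in> {1..<m}" for j
  proof -
    let ?q = "real j / real m"
    have q: "0 < ?q" "?q < 1" using j by auto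
    have "\<forall>\<^sub>F x in at_bot. cdf \<nu> x < ?q" using cdf_lim_at_bot q by (auto dest: order_tendstoD)
    then obtain a where a: "\<And>x. x \<le> a \<Longrightarrow> cdf \<nu> x < ?q" by (auto simp: eventually_at_bot_linorder)
    have "\<forall>\<^sub>F x in at_top. cdf \<nu> x > ?q" using cdf_lim_at_top_prob q by (auto dest: order_tendstoD)
    then obtain b where b: "\<And>x. b \<le> x \<Longrightarrow> cdf \<nu> x > ?q" by (auto simp: eventually_at_top_linorder)
    have "\<exists>x\<ge>min a b. x \<le> b \<and> cdf \<nu> x = ?q"
      using a[of "min a b"] b[of b] atomless
      by (intro IVT) (auto simp: isCont_cdf intro: less_imp_le)
    then show ?thesis by blast
  qed
  then have "\<forall>j\<in>{1..<m}. \<exists>t. measure \<nu> {..t} = real j / real m"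
    by (simp add: cdf_def)
  then show ?thesis by metis
qed

text \<open>A lower set lies between two consecutive half-lines of the quantile grid, whose measures
  under \<open>\<nu>\<close> differ by \<open>1 / m\<close>.\<close>

lemma lower_close_grid:
  assumes "prob_space \<mu>" and "prob_space \<nu>"
    and s: "sets \<mu> = sets borel" "sets \<nu> = sets borel"
    and m: "0 < m" and t: "\<And>j. j \<in> {1..<m} \<Longrightarrow> measure \<nu> {..t j} = real j / real m"
    and \<eta>: "\<And>j. j \<in> {1..<m} \<Longrightarrow> \<bar>measure \<mu> {..t j} - measure \<nu> {..t j}\<bar> \<le> \<eta>" "0 \<le> \<eta>"
  shows "lower_close (1 / real m + \<eta>) \<mu> \<nu>"
  unfolding lower_close_def
proof (intro ballI impI)
  interpret \<mu>: prob_space \<mu> by fact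
  interpret \<nu>: prob_space \<nu> by fact
  fix D :: "real set" assume D: "D \<in> sets borel" "\<forall>x\<in>D. \<forall>y\<le>x. y \<in> D"
  let ?P = "\<lambda>j. 1 \<le> j \<and> (j = m \<or> t j \<notin> D)"
  define j where "j = (LEAST j. ?P j)"
  have "?P m" using m by simp
  then have j: "?P j" and jm: "j \<le> m"
    unfolding j_def by (rule LeastI, rule Least_le)
  have up: "measure \<mu> D \<le> real j / real m + \<eta> \<and> measure \<nu> D \<le> real j / real m"
  proof (cases "j = m")
    case True
    then show ?thesis using m \<eta>(2) by (auto intro: add_increasing2)
  next
    case False
    then have jj: "j \<in> {1..<m}" and "t j \<notin> D" using j jm by auto
    then have sub: "D \<subseteq> {..t j}" using D(2) by (meson atMost_iff linear subsetI)
    then have "measure \<mu> D \<le> measure \<mu> {..t j}" "measure \<nu> D \<le> measure \<nu> {..t j}"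
      by (intro \<mu>.finite_measure_mono \<nu>.finite_measure_mono; simp add: s)+
    then show ?thesis using t[OF jj] \<eta>(1)[OF jj] by auto
  qed
  have lo: "real j / real m - 1 / real m - \<eta> \<le> measure \<mu> D \<and> real j / real m - 1 / real m \<le> measure \<nu> D"
    proof (cases "j = 1")
      case True
      have "- \<eta> \<le> measure \<mu> D" using \<eta>(2) measure_nonneg[of \<mu> D] by linarith
      then show ?thesis using True by simp
    next
      case False
      define i where "i = j - 1"
      have i: "i \<in> {1..<m}" "j = Suc i" using False j jm by (auto simp: i_def)
      have "\<not> ?P i" using i(2) not_less_Least[of i ?P] unfolding j_def[symmetric] by simp
      then have "t i \<in> D" using i by auto
      then have sub: "{..t i} \<subseteq> D" using D(2) by auto
      then have "measure \<mu> {..t i} \<le> measure \<mu> D" "measure \<nu> {..t i} \<le> measure \<nu> D"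
        using D(1) by (intro \<mu>.finite_measure_mono \<nu>.finite_measure_mono; simp add: s)+
      moreover have "real j / real m - 1 / real m = real i / real m"
        using i(2) by (simp flip: diff_divide_distrib)
      ultimately show ?thesis using t[OF i(1)] \<eta>(1)[OF i(1)] by auto
    qed
  show "\<bar>measure \<mu> D - measure \<nu> D\<bar> \<le> 1 / real m + \<eta>"
    using up lo by linarith
qed

section \<open>Empirical measures\<close>

definition empirical :: "nat \<Rightarrow> (nat \<Rightarrow> real) \<Rightarrow> real measure" where
  "empirical n x = distr (measure_pmf (pmf_of_set {1..n})) borel x"

lemma sets_empirical [simp]: "sets (empirical n x) = sets borel"
  by (simp add: empirical_def)

lemma prob_space_empirical: "prob_space (empirical n x)"
  unfolding empirical_def by (intro measure_pmf.prob_space_distr) simp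

lemma integral_empirical:
  fixes h :: "real \<Rightarrow> real"
  assumes "1 \<le> n" and [measurable]: "h \<in> borel_measurable borel"
  shows "integral\<^sup>L (empirical n x) h = (1 / real n) * (\<Sum>i=1..n. h (x i))"
proof -
  have "integral\<^sup>L (empirical n x) h = (\<integral>i. h (x i) \<partial>measure_pmf (pmf_of_set {1..n}))"
    unfolding empirical_def by (intro integral_distr) auto
  also have "\<dots> = (\<Sum>i=1..n. h (x i)) / real (card {1..n})"
    using assms(1) by (intro integral_pmf_of_set) auto
  finally show ?thesis by simp
qed

lemma measure_empirical:
  assumes "1 \<le> n" and D: "D \<in> sets borel"
  shows "measure (empirical n x) D = (1 / real n) * (\<Sum>i=1..n. indicator D (x i))"
proof -
  interpret prob_space "empirical n x" by (rule prob_space_empirical)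
  have "measure (empirical n x) D = integral\<^sup>L (empirical n x) (indicator D)"
    using D sets_eq_imp_space_eq[OF sets_empirical] by simp
  then show ?thesis using integral_empirical[of n "indicator D" x] assms by simp
qed

section \<open>The likelihood criterion\<close>

lemma Phi_eq:
  assumes n: "1 \<le> n" and pos: "\<And>i. i \<in> {1..n} \<Longrightarrow> 0 < mixture p u1 u2 (\<lambda>y. exp_ext (\<psi> y)) (x i)"
    and int: "integrable lborel (\<lambda>y. exp_ext (\<psi> y))"
  shows "Phi n x p u1 u2 \<psi> = ereal ((1 / real n) * (\<Sum>i=1..n. ln (mixture p u1 u2 (\<lambda>y. exp_ext (\<psi> y)) (x i)))
    - (\<integral>y. exp_ext (\<psi> y) \<partial>lborel))"
proof -
  have "(\<Sum>i=1..n. ln_ext (mixture p u1 u2 (\<lambda>y. exp_ext (\<psi> y)) (x i)))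
      = (\<Sum>i=1..n. ereal (ln (mixture p u1 u2 (\<lambda>y. exp_ext (\<psi> y)) (x i))))"
    using pos by (intro sum.cong) (force simp: ln_ext_def)+
  then show ?thesis
    unfolding Phi_def using int by (simp add: nn_integral_eq_integral enn2ereal_ennreal)
qed

lemma Phi_finiteD:
  assumes \<psi>: "\<psi> \<in> SC" and n: "1 \<le> n" and p: "0 \<le> p" "p \<le> 1" and fin: "Phi n x p u1 u2 \<psi> \<noteq> -\<infinity>"
  shows "\<And>i. i \<in> {1..n} \<Longrightarrow> 0 < mixture p u1 u2 (\<lambda>y. exp_ext (\<psi> y)) (x i)"
    and "integrable lborel (\<lambda>y. exp_ext (\<psi> y))"
proof -
  let ?f = "\<lambda>y. exp_ext (\<psi> y)"
  let ?l = "\<lambda>i. ln_ext (mixture p u1 u2 ?f (x i))"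
  have S: "(\<Sum>i=1..n. ?l i) \<noteq> \<infinity>"
    unfolding sum_Pinfty by (auto simp: ln_ext_def)
  have nI: "enn2ereal (\<integral>\<^sup>+y. ennreal (?f y) \<partial>lborel) \<noteq> -\<infinity>"
    by (metis MInfty_neq_ereal(1) enn2ereal_nonneg not_MInfty_nonneg)
  have S': "(\<Sum>i=1..n. ?l i) \<noteq> -\<infinity>"
  proof
    assume "(\<Sum>i=1..n. ?l i) = -\<infinity>"
    then have "ereal (1 / real n) * (\<Sum>i=1..n. ?l i) = -\<infinity>"
      using n by simp
    then show False using fin nI unfolding Phi_def
      by (cases "enn2ereal (\<integral>\<^sup>+y. ennreal (?f y) \<partial>lborel)") auto
  qed
  show "0 < mixture p u1 u2 ?f (x i)" if i: "i \<in> {1..n}" for i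
  proof (rule ccontr)
    assume "\<not> ?thesis"
    moreover have "0 \<le> mixture p u1 u2 ?f (x i)" using p by (simp add: mixture_def)
    ultimately have "?l i = -\<infinity>" by (simp add: ln_ext_def)
    moreover have "(\<Sum>i=1..n. ?l i) = ?l i + (\<Sum>j\<in>{1..n}-{i}. ?l j)"
      using i by (intro sum.remove) auto
    moreover have "(\<Sum>j\<in>{1..n}-{i}. ?l j) \<noteq> \<infinity>"
      unfolding sum_Pinfty by (auto simp: ln_ext_def)
    ultimately show False using S' by (cases "\<Sum>j\<in>{1..n}-{i}. ?l j") auto
  qed
  have "(\<integral>\<^sup>+y. ennreal (?f y) \<partial>lborel) \<noteq> \<infinity>"
  proof
    assume a: "(\<integral>\<^sup>+y. ennreal (?f y) \<partial>lborel) = \<infinity>"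
    obtain r where "(\<Sum>i=1..n. ?l i) = ereal r"
      using S S' by (cases "\<Sum>i=1..n. ?l i") auto
    then show False using fin a unfolding Phi_def by simp
  qed
  then show "integrable lborel ?f"
    using elc_measurable[OF even_logconcave_exp_ext[OF \<psi>]]
    by (intro integrableI_nonneg) (auto simp: less_top)
qed

text \<open>Adding a constant \<open>c\<close> to \<open>\<psi>\<close> changes the criterion by \<open>c - (exp c - 1) I\<close>, where \<open>I\<close> is
  the integral of \<open>exp \<psi>\<close>. At a maximizer this is never positive; \<open>c = 1\<close> excludes \<open>I = 0\<close>, and
  \<open>c = - ln I\<close> then forces \<open>I = 1\<close>.\<close>

lemma maximizer_density:
  assumes n: "1 \<le> n" and p: "0 \<le> p" "p \<le> 1"
    and max: "is_arg_max (Phi n x p u1 u2) (\<lambda>\<psi>. \<psi> \<in> SC) \<psi>" and fin: "Phi n x p u1 u2 \<psi> \<noteq> -\<infinity>"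
  shows "elc_density (\<lambda>y. exp_ext (\<psi> y))"
proof -
  let ?f = "\<lambda>y. exp_ext (\<psi> y)"
  let ?L = "(1 / real n) * (\<Sum>i=1..n. ln (mixture p u1 u2 ?f (x i)))"
  define I where "I = integral\<^sup>L lborel ?f"
  have \<psi>: "\<psi> \<in> SC" and mx: "\<And>\<phi>. \<phi> \<in> SC \<Longrightarrow> Phi n x p u1 u2 \<phi> \<le> Phi n x p u1 u2 \<psi>"
    using max by (auto simp: is_arg_max_def not_less)
  note pos = Phi_finiteD(1)[OF \<psi> n p fin] and int = Phi_finiteD(2)[OF \<psi> n p fin]
  have I0: "0 \<le> I" unfolding I_def by (intro Bochner_Integration.integral_nonneg) auto
  have key: "c + I \<le> exp c * I" for c
  proof -
    let ?\<phi> = "\<lambda>y. \<psi> y + ereal c"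
    have ex: "exp_ext (?\<phi> y) = exp c * ?f y" for y
      by (rule exp_ext_add[OF SC_less_infinity[OF \<psi>]])
    have mix: "mixture p u1 u2 (\<lambda>y. exp c * ?f y) z = exp c * mixture p u1 u2 ?f z" for z
      unfolding mixture_def by (simp add: algebra_simps)
    have "Phi n x p u1 u2 ?\<phi> = ereal ((1 / real n) * (\<Sum>i=1..n. ln (exp c * mixture p u1 u2 ?f (x i))) - exp c * I)"
      using pos int by (subst Phi_eq[OF n]) (auto simp: mix ex I_def)
    also have "(\<Sum>i=1..n. ln (exp c * mixture p u1 u2 ?f (x i))) = (\<Sum>i=1..n. c + ln (mixture p u1 u2 ?f (x i)))"
      using pos by (intro sum.cong refl) (simp add: ln_mult_pos)
    also have "(1 / real n) * \<dots> = c + ?L"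
      using n by (simp add: sum.distrib field_simps)
    finally have "ereal (c + ?L - exp c * I) \<le> ereal (?L - I)"
      using mx[OF SC_add_const[OF \<psi>, of c]] Phi_eq[OF n pos int] by (simp add: I_def)
    then show ?thesis by simp
  qed
  have "I \<noteq> 0" using key[of 1] by auto
  then have I: "0 < I" using I0 by simp
  have "ln I \<ge> I - 1" using key[of "- ln I"] I by (simp add: exp_minus)
  then have "ln I = I - 1" using ln_le_minus_one[OF I] by simp
  then have "I = 1" using ln_eq_minus_one[OF I] by simp
  then show ?thesis
    unfolding elc_density_def has_bochner_integral_iff
    using even_logconcave_exp_ext[OF \<psi>] int by (simp add: I_def)
qed

text \<open>The maximizer is compared with the stretched truth, whose mixture is at least
  \<open>(1 - d / k)\<close> times the true mixture at every observation. The last term on the left pays for the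
  excess mass of the plateau.\<close>

lemma basic_inequality:
  assumes \<psi>0: "\<psi>0 \<in> SC" and f0: "f0 = (\<lambda>y. exp_ext (\<psi>0 y))" "elc_density f0"
    and p0: "0 < p0" "p0 < 1" and k: "k = min p0 (1 - p0)" and d: "d < k"
    and p: "\<bar>p - p0\<bar> \<le> d" and u: "\<bar>u1 - v1\<bar> \<le> d" "\<bar>u2 - v2\<bar> \<le> d"
    and n: "1 \<le> n" and pos0: "\<And>i. i \<in> {1..n} \<Longrightarrow> 0 < mixture p0 v1 v2 f0 (x i)"
    and max: "is_arg_max (Phi n x p u1 u2) (\<lambda>\<psi>. \<psi> \<in> SC) \<psi>" and f: "f = (\<lambda>y. exp_ext (\<psi> y))"
  shows "elc_density f" and "\<And>i. i \<in> {1..n} \<Longrightarrow> 0 < mixture p u1 u2 f (x i)"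
    and "(1 / real n) * (\<Sum>i=1..n. ln (mixture p0 v1 v2 f0 (x i))) + ln (1 - d / k) - 2 * d * f0 0
      \<le> (1 / real n) * (\<Sum>i=1..n. ln (mixture p u1 u2 f (x i)))"
proof -
  let ?\<phi> = "\<lambda>x. \<psi>0 (max 0 (\<bar>x\<bar> - d))"
  let ?g = "\<lambda>i. mixture p u1 u2 (plateau d f0) (x i)"
  let ?q = "\<lambda>i. mixture p0 v1 v2 f0 (x i)"
  have d0: "0 \<le> d" and k0: "0 < k" and p01: "0 \<le> p" "p \<le> 1" using p p0 k d by auto
  have dk: "0 < 1 - d / k" using d k0 by simp
  have \<phi>: "?\<phi> \<in> SC" by (rule SC_plateau[OF \<psi>0 d0])
  have ex: "(\<lambda>y. exp_ext (?\<phi> y)) = plateau d f0" by (simp add: f0(1) plateau_def fun_eq_iff)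
  have ge: "(1 - d / k) * ?q i \<le> ?g i" for i
    by (rule mixture_plateau_ge[OF f0(2) p0 k p _ u]) (use d in simp)
  have pos: "0 < ?g i" if "i \<in> {1..n}" for i
    using ge[of i] mult_pos_pos[OF dk pos0[OF that]] by linarith
  have "ln (1 - d / k) + ln (?q i) \<le> ln (?g i)" if "i \<in> {1..n}" for i
  proof -
    have "ln ((1 - d / k) * ?q i) \<le> ln (?g i)"
      using ge[of i] mult_pos_pos[OF dk pos0[OF that]] by (intro ln_mono)
    then show ?thesis using dk pos0[OF that] by (simp add: ln_mult_pos)
  qed
  then have "(\<Sum>i=1..n. ln (1 - d / k) + ln (?q i)) \<le> (\<Sum>i=1..n. ln (?g i))"
    by (rule sum_mono)
  then have "(1 / real n) * (\<Sum>i=1..n. ln (1 - d / k) + ln (?q i)) \<le> (1 / real n) * (\<Sum>i=1..n. ln (?g i))"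
    by (rule mult_left_mono) simp
  moreover have "(1 / real n) * (\<Sum>i=1..n. ln (1 - d / k) + ln (?q i))
      = ln (1 - d / k) + (1 / real n) * (\<Sum>i=1..n. ln (?q i))"
    using n by (simp add: sum.distrib field_simps)
  ultimately have lower: "ln (1 - d / k) + (1 / real n) * (\<Sum>i=1..n. ln (?q i))
      \<le> (1 / real n) * (\<Sum>i=1..n. ln (?g i))" by simp
  have P: "Phi n x p u1 u2 ?\<phi> = ereal ((1 / real n) * (\<Sum>i=1..n. ln (?g i)) - integral\<^sup>L lborel (plateau d f0))"
    using Phi_eq[OF n, of p u1 u2 ?\<phi> x] pos plateau_integrable[OF f0(2) d0] unfolding ex by simp
  have \<psi>: "\<psi> \<in> SC" and mx: "Phi n x p u1 u2 ?\<phi> \<le> Phi n x p u1 u2 \<psi>"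
    using max \<phi> by (auto simp: is_arg_max_def not_less)
  have fin: "Phi n x p u1 u2 \<psi> \<noteq> -\<infinity>" using mx unfolding P by auto
  show e: "elc_density f" unfolding f by (rule maximizer_density[OF n p01 max fin])
  show fpos: "0 < mixture p u1 u2 f (x i)" if "i \<in> {1..n}" for i
    unfolding f by (rule Phi_finiteD(1)[OF \<psi> n p01 fin that])
  have "Phi n x p u1 u2 \<psi> = ereal ((1 / real n) * (\<Sum>i=1..n. ln (mixture p u1 u2 f (x i))) - 1)"
    using Phi_eq[OF n, of p u1 u2 \<psi> x] fpos elcd_integrable[OF e] elcd_integral[OF e] unfolding f by simp
  with mx have "(1 / real n) * (\<Sum>i=1..n. ln (?g i)) - integral\<^sup>L lborel (plateau d f0)
      \<le> (1 / real n) * (\<Sum>i=1..n. ln (mixture p u1 u2 f (x i))) - 1"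
    unfolding P by simp
  then show "(1 / real n) * (\<Sum>i=1..n. ln (?q i)) + ln (1 - d / k) - 2 * d * f0 0
      \<le> (1 / real n) * (\<Sum>i=1..n. ln (mixture p u1 u2 f (x i)))"
    using lower plateau_integral_le[OF f0(2) d0] by linarith
qed

section \<open>The likelihood controls the peak\<close>

text \<open>A density in the class with a high peak is small away from \<open>0\<close>: by log-concavity
  \<open>f 0 * f r \<le> (f (r/2))\<^sup>2 \<le> 1 / r\<^sup>2\<close>. So the few observations near the two centres gain less
  likelihood from a high peak than the others lose.\<close>

lemma peak_bound:
  assumes f: "elc_density f" and p: "0 \<le> p" "p \<le> 1" and r: "0 < r" and n: "1 \<le> n"
    and pos: "\<And>i. i \<in> {1..n} \<Longrightarrow> 0 < mixture p u1 u2 f (x i)"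
    and N: "N \<in> sets borel" "{u1 - r..u1 + r} \<union> {u2 - r..u2 + r} \<subseteq> N"
    and w: "measure (empirical n x) N \<le> 1 / 4"
    and C: "C \<le> (1 / real n) * (\<Sum>i=1..n. ln (mixture p u1 u2 f (x i)))"
  shows "f 0 \<le> max (1 / r) (exp (- 2 * C - 3 * ln r))"
proof (cases "f 0 \<le> 1 / r")
  case False
  note e = elcd_elc[OF f]
  have f0: "0 < f 0" by (rule elcd_pos_0[OF f])
  define l where "l = ln (f 0)"
  define A where "A = - 2 * ln r - l"
  have l: "- ln r < l" using False f0 r unfolding l_def
    by (metis ln_inverse inverse_eq_divide ln_less_cancel_iff not_le zero_less_divide_1_iff)
  have "f (r / 2) \<le> 1 / r" using elcd_le[OF f, of "r / 2"] r by simp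
  then have "(f (r / 2))\<^sup>2 \<le> (1 / r)\<^sup>2" using elc_nonneg[OF e] by (intro power_mono)
  then have "f 0 * f r \<le> 1 / r\<^sup>2" using elc_midpoint[OF e, of "r / 2"] by (simp add: power_divide)
  then have fr: "f r \<le> 1 / (r\<^sup>2 * f 0)" using f0 r by (simp add: field_simps)
  have lnA: "ln (1 / (r\<^sup>2 * f 0)) = A"
    using r f0 by (simp add: A_def l_def ln_div ln_mult_pos ln_realpow)
  have pt: "ln (mixture p u1 u2 f (x i)) \<le> (l - A) * indicator N (x i) + A" if i: "i \<in> {1..n}" for i
  proof (cases "x i \<in> N")
    case True
    have "ln (mixture p u1 u2 f (x i)) \<le> l"
      unfolding l_def using mixture_le[OF f p] pos[OF i] by (intro ln_mono)
    then show ?thesis using True by simp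
  next
    case False
    then have "x i \<notin> {u1 - r..u1 + r}" "x i \<notin> {u2 - r..u2 + r}" using N(2) by blast+
    then have "r \<le> \<bar>x i - u1\<bar>" "r \<le> \<bar>x i - u2\<bar>" by auto
    then have "f (x i - u1) \<le> f r" "f (x i - u2) \<le> f r"
      using r by (auto intro!: elc_antimono_abs[OF e])
    then have "mixture p u1 u2 f (x i) \<le> p * f r + (1 - p) * f r"
      unfolding mixture_def using p by (intro add_mono mult_left_mono) auto
    also have "\<dots> \<le> 1 / (r\<^sup>2 * f 0)" using fr by (simp add: algebra_simps)
    finally have "ln (mixture p u1 u2 f (x i)) \<le> ln (1 / (r\<^sup>2 * f 0))"
      using pos[OF i] by (intro ln_mono)
    then show ?thesis using False lnA by simp
  qed
  have "C \<le> (1 / real n) * (\<Sum>i=1..n. ln (mixture p u1 u2 f (x i)))" by (rule C)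
  also have "\<dots> \<le> (1 / real n) * (\<Sum>i=1..n. (l - A) * indicator N (x i) + A)"
    using pt by (intro mult_left_mono sum_mono) auto
  also have "\<dots> = (l - A) * measure (empirical n x) N + A"
    unfolding measure_empirical[OF n N(1)] sum.distrib sum_distrib_left[symmetric] using n
    by (simp add: distrib_left)
  also have "\<dots> \<le> (l - A) * (1 / 4) + A"
    using w l by (intro add_right_mono mult_left_mono) (auto simp: A_def)
  finally have "4 * C \<le> (l - A) + 4 * A" by (simp add: field_simps)
  then have "l \<le> - 2 * C - 3 * ln r" unfolding A_def by simp
  then have "f 0 \<le> exp (- 2 * C - 3 * ln r)"
    using f0 exp_le_cancel_iff[of l] by (simp add: l_def)
  then show ?thesis by simp
qed simp

section \<open>From likelihood to Hellinger and total variation distance\<close>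

text \<open>The variation function of an even function that decreases away from \<open>0\<close>.\<close>

definition variation :: "(real \<Rightarrow> real) \<Rightarrow> real \<Rightarrow> real" where
  "variation f x = (if x < 0 then f x else 2 * f 0 - f x)"

lemma variation_properties:
  assumes f: "even_logconcave f"
  shows "0 \<le> variation f x" "variation f x \<le> 2 * f 0"
    and "x \<le> y \<Longrightarrow> \<bar>f y - f x\<bar> \<le> variation f y - variation f x"
  using elc_nonneg[OF f, of x] elc_le_0[OF f, of x] elc_nonneg[OF f, of y] elc_le_0[OF f, of y]
    elc_antimono_abs[OF f, of x y] elc_antimono_abs[OF f, of y x]
  by (auto simp: variation_def)

lemma ln_add_diff_le:
  fixes a b c :: real
  assumes "0 < c" "0 \<le> a" "0 \<le> b"
  shows "\<bar>ln (a + c) - ln (b + c)\<bar> \<le> \<bar>a - b\<bar> / c"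
proof -
  have *: "\<bar>ln (a + c) - ln (b + c)\<bar> \<le> \<bar>a - b\<bar> / c" if "b \<le> a" "0 \<le> b" for a b :: real
  proof -
    have p: "0 < a + c" "0 < b + c" using that assms by auto
    have "ln (a + c) - ln (b + c) = ln ((a + c) / (b + c))" using p by (simp add: ln_div)
    also have "\<dots> \<le> (a + c) / (b + c) - 1" using p by (intro ln_le_minus_one) auto
    also have "\<dots> = (a - b) / (b + c)" using p by (simp add: field_simps)
    also have "\<dots> \<le> (a - b) / c" using that assms by (intro divide_left_mono) auto
    finally show ?thesis using that p by simp
  qed
  show ?thesis
    using *[of b a] *[of a b] assms by (cases "b \<le> a") (auto simp: abs_minus_commute)
qed

text \<open>The inequality \<open>ln z \<le> 2 (sqrt z - 1)\<close> at \<open>z = (a + c) / b\<close>, followed by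
  \<open>sqrt (a + c) \<le> sqrt a + sqrt c\<close>. The number \<open>c\<close> regularizes the logarithm near \<open>a = 0\<close>.\<close>

lemma ln_ratio_hellinger:
  fixes a b c :: real
  assumes a: "0 \<le> a" and b: "0 \<le> b" and c: "0 < c"
  shows "b * ln (a + c) - b * ln b \<le> a - b - (sqrt a - sqrt b)\<^sup>2 + 2 * sqrt c * sqrt b"
proof (cases "b = 0")
  case False
  then have b: "0 < b" using b by simp
  let ?z = "(a + c) / b"
  have z: "0 < ?z" using a b c by simp
  have "ln (sqrt ?z) \<le> sqrt ?z - 1" using z by (intro ln_le_minus_one) auto
  then have "ln ?z \<le> 2 * (sqrt ?z - 1)" using z by (simp add: ln_sqrt)
  then have "b * (ln (a + c) - ln b) \<le> b * (2 * (sqrt ?z - 1))"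
    using a b c by (intro mult_left_mono) (auto simp: ln_div)
  also have "b * (2 * (sqrt ?z - 1)) = 2 * (b * sqrt ?z) - 2 * b" by (simp add: algebra_simps)
  also have "b * sqrt ?z = sqrt b * sqrt (a + c)"
    using b by (simp add: real_sqrt_divide real_div_sqrt flip: real_sqrt_mult)
      (metis less_eq_real_def mult.commute real_div_sqrt real_sqrt_mult times_divide_eq_left)
  also have "\<dots> \<le> sqrt b * (sqrt a + sqrt c)"
    using a c b by (intro mult_left_mono sqrt_add_le_add_sqrt) auto
  also have "2 * (sqrt b * (sqrt a + sqrt c)) - 2 * b = a - b - (sqrt a - sqrt b)\<^sup>2 + 2 * sqrt c * sqrt b"
    using a b by (simp add: power2_diff algebra_simps)
  finally show ?thesis by (simp add: algebra_simps)
qed (use a in simp)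

lemma prob_space_mixture:
  assumes f: "elc_density f" and p: "0 \<le> p" "p \<le> 1"
  shows "prob_space (density lborel (\<lambda>x. ennreal (mixture p u1 u2 f x)))" (is "prob_space ?G")
proof
  note [measurable] = mixture_measurable[OF f p]
  show "emeasure ?G (space ?G) = 1"
    using mixture_nonneg[OF f p] mixture_integrable[OF f p] mixture_integral[OF f p, of u1 u2]
    by (simp add: emeasure_density nn_integral_eq_integral)
qed

lemma measure_mixture_interval_le:
  assumes f: "elc_density f" and p: "0 \<le> p" "p \<le> 1" and "a \<le> b"
  shows "measure (density lborel (\<lambda>x. ennreal (mixture p u1 u2 f x))) {a..b} \<le> f 0 * (b - a)"
    (is "measure ?G _ \<le> _")
proof -
  note [measurable] = mixture_measurable[OF f p]
  interpret prob_space ?G by (rule prob_space_mixture[OF f p])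
  have "emeasure ?G {a..b} = (\<integral>\<^sup>+x. ennreal (mixture p u1 u2 f x) * indicator {a..b} x \<partial>lborel)"
    by (simp add: emeasure_density)
  also have "\<dots> \<le> (\<integral>\<^sup>+x. ennreal (f 0) * indicator {a..b} x \<partial>lborel)"
    using mixture_le[OF f p] by (intro nn_integral_mono mult_right_mono ennreal_leI) auto
  also have "\<dots> = ennreal (f 0 * (b - a))"
    using assms(4) elcd_pos_0[OF f] by (simp add: nn_integral_cmult ennreal_mult)
  finally show ?thesis
    using assms(4) elcd_pos_0[OF f] by (simp add: emeasure_eq_measure)
qed

text \<open>Replacing \<open>ln g\<close> by \<open>ln (g + c)\<close> increases the likelihood and gives a function whose increments
  are bounded by those of a shifted mixture of \<open>variation f\<close>, divided by \<open>c\<close>. Therefore the sample average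
  may be exchanged for the integral under the true law, at a cost proportional to \<open>d\<close>.\<close>

lemma likelihood_hellinger:
  fixes x :: "nat \<Rightarrow> real"
  assumes f: "elc_density f" and f0: "elc_density f0" and p: "0 \<le> p" "p \<le> 1" and p0: "0 \<le> p0" "p0 \<le> 1"
    and c: "0 < c" and n: "1 \<le> n" and d: "0 \<le> d" and K: "f 0 \<le> K"
    and close: "lower_close d (empirical n x) (density lborel (\<lambda>y. ennreal (mixture p0 v1 v2 f0 y)))"
    and pos: "\<And>i. i \<in> {1..n} \<Longrightarrow> 0 < mixture p u1 u2 f (x i)"
    and L: "(\<integral>y. mixture p0 v1 v2 f0 y * ln (mixture p0 v1 v2 f0 y) \<partial>lborel) - e
      \<le> (1 / real n) * (\<Sum>i=1..n. ln (mixture p u1 u2 f (x i)))"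
  shows "(\<integral>y. (sqrt (mixture p u1 u2 f y) - sqrt (mixture p0 v1 v2 f0 y))\<^sup>2 \<partial>lborel)
    \<le> e + (ln (K + c) - ln c + 4 * K / c) * d + 2 * sqrt c * (\<integral>y. sqrt (mixture p0 v1 v2 f0 y) \<partial>lborel)"
proof -
  let ?g = "mixture p u1 u2 f" and ?q = "mixture p0 v1 v2 f0"
  let ?G = "density lborel (\<lambda>y. ennreal (?q y))"
  let ?h = "\<lambda>y. ln (?g y + c)"
  note g = mixture_measurable[OF f p, of u1 u2] mixture_nonneg[OF f p, of u1 u2] mixture_integrable[OF f p, of u1 u2]
  note g0 = mixture_measurable[OF f0 p0, of v1 v2] mixture_nonneg[OF f0 p0, of v1 v2] mixture_integrable[OF f0 p0, of v1 v2]
  note [measurable] = g(1) g0(1)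
  have K0: "0 < K" using K elcd_pos_0[OF f] by linarith
  have G: "prob_space ?G" by (rule prob_space_mixture[OF f0 p0])
  have sG: "sets ?G = sets borel" by simp
  let ?V = "\<lambda>y. (p * variation f (y - u1) + (1 - p) * variation f (y - u2)) / c"
  note v = variation_properties[OF elcd_elc[OF f]]
  have hb: "ln c \<le> ?h y" "?h y \<le> ln (K + c)" for y
    using g(2)[of y] mixture_le[OF f p, of u1 u2 y] K c by (auto intro!: ln_mono)
  have V0: "0 \<le> ?V y" for y using v(1) p c by simp
  have V1: "?V y \<le> 2 * K / c" for y
  proof -
    have "p * variation f (y - u1) + (1 - p) * variation f (y - u2) \<le> p * (2 * K) + (1 - p) * (2 * K)"
      using order_trans[OF v(2), of "2 * K"] K p by (intro add_mono mult_left_mono) auto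
    then show ?thesis using c by (intro divide_right_mono) (auto simp: algebra_simps)
  qed
  have V2: "\<bar>?h z - ?h y\<bar> \<le> ?V z - ?V y" if "y \<le> z" for y z
  proof -
    have "\<bar>?h z - ?h y\<bar> \<le> \<bar>?g z - ?g y\<bar> / c" using ln_add_diff_le[OF c g(2) g(2)] .
    also have "\<bar>?g z - ?g y\<bar> \<le> p * \<bar>f (z - u1) - f (y - u1)\<bar> + (1 - p) * \<bar>f (z - u2) - f (y - u2)\<bar>"
    proof -
      have "?g z - ?g y = p * (f (z - u1) - f (y - u1)) + (1 - p) * (f (z - u2) - f (y - u2))"
        by (simp add: mixture_def algebra_simps)
      then show ?thesis using abs_triangle_ineq p by (metis abs_mult abs_of_nonneg diff_ge_0_iff_ge)
    qed
    also have "\<dots> \<le> p * (variation f (z - u1) - variation f (y - u1)) + (1 - p) * (variation f (z - u2) - variation f (y - u2))"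
      using p that by (intro add_mono mult_left_mono v(3)) auto
    also have "\<dots> / c = ?V z - ?V y" by (simp add: diff_divide_distrib algebra_simps add_divide_distrib)
    finally show ?thesis using c by (simp add: divide_right_mono)
  qed
  have hm: "?h \<in> borel_measurable borel" by measurable
  have "(1 / real n) * (\<Sum>i=1..n. ln (?g (x i))) \<le> (1 / real n) * (\<Sum>i=1..n. ?h (x i))"
    using pos c by (intro mult_left_mono sum_mono ln_mono) auto
  also have "\<dots> = integral\<^sup>L (empirical n x) ?h" by (rule integral_empirical[OF n hm, symmetric])
  also have "\<dots> \<le> integral\<^sup>L ?G ?h + (ln (K + c) - ln c + 2 * (2 * K / c)) * d"
    by (rule bounded_variation_integral_le[OF prob_space_empirical G sets_empirical sG close d hm hb V0 V1 V2])
  also have "integral\<^sup>L ?G ?h = (\<integral>y. ?q y * ?h y \<partial>lborel)"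
    using g0(2) by (subst integral_density) auto
  finally have main: "(\<integral>y. ?q y * ln (?q y) \<partial>lborel) - e
      \<le> (\<integral>y. ?q y * ?h y \<partial>lborel) + (ln (K + c) - ln c + 4 * K / c) * d"
    using L by simp
  have ih: "integrable lborel (\<lambda>y. ?q y * ?h y)"
  proof -
    have "integrable lborel (\<lambda>y. (\<bar>ln c\<bar> + \<bar>ln (K + c)\<bar>) * ?q y)" using g0(3) by simp
    then show ?thesis
    proof (rule Bochner_Integration.integrable_bound)
      have "\<bar>?q y * ?h y\<bar> \<le> (\<bar>ln c\<bar> + \<bar>ln (K + c)\<bar>) * ?q y" for y
      proof -
        have "\<bar>?h y\<bar> \<le> \<bar>ln c\<bar> + \<bar>ln (K + c)\<bar>" using hb[of y] by linarith
        from mult_left_mono[OF this g0(2)[of y]] show ?thesis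
          using g0(2)[of y] by (simp add: abs_mult mult.commute)
      qed
      then show "AE y in lborel. norm (?q y * ?h y) \<le> norm ((\<bar>ln c\<bar> + \<bar>ln (K + c)\<bar>) * ?q y)"
        using g0(2) by (auto simp: abs_mult)
    qed measurable
  qed
  have iH: "integrable lborel (\<lambda>y. (sqrt (?g y) - sqrt (?q y))\<^sup>2)"
  proof -
    have "integrable lborel (\<lambda>y. ?g y + ?q y)" using g(3) g0(3) by simp
    then show ?thesis
    proof (rule Bochner_Integration.integrable_bound)
      have "(sqrt (?g y) - sqrt (?q y))\<^sup>2 \<le> ?g y + ?q y" for y
        using g(2) g0(2) by (simp add: power2_diff)
      then show "AE y in lborel. norm ((sqrt (?g y) - sqrt (?q y))\<^sup>2) \<le> norm (?g y + ?q y)"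
        by (auto intro: order_trans[OF _ abs_ge_self])
    qed measurable
  qed
  note iS = mixture_sqrt_integrable[OF f0 p0, of v1 v2] and ie = mixture_ln_integrable[OF f0 p0, of v1 v2]
  have "(\<integral>y. ?q y * ?h y \<partial>lborel) - (\<integral>y. ?q y * ln (?q y) \<partial>lborel)
      = (\<integral>y. ?q y * ?h y - ?q y * ln (?q y) \<partial>lborel)"
    using ih ie by simp
  also have "\<dots> \<le> (\<integral>y. ?g y - ?q y - (sqrt (?g y) - sqrt (?q y))\<^sup>2 + 2 * sqrt c * sqrt (?q y) \<partial>lborel)"
    using ih ie g(3) g0(3) iH iS ln_ratio_hellinger[OF g(2) g0(2) c]
    by (intro integral_mono) auto
  also have "\<dots> = 1 - 1 - (\<integral>y. (sqrt (?g y) - sqrt (?q y))\<^sup>2 \<partial>lborel) + 2 * sqrt c * (\<integral>y. sqrt (?q y) \<partial>lborel)"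
    using g(3) g0(3) iH iS mixture_integral[OF f p, of u1 u2] mixture_integral[OF f0 p0, of v1 v2] by simp
  finally show ?thesis using main by linarith
qed

text \<open>The factorization \<open>g - h = (sqrt g - sqrt h) (sqrt g + sqrt h)\<close> and the inequality between
  arithmetic and geometric means with weight \<open>t\<close>.\<close>

lemma L1_le_hellinger:
  fixes g h :: "real \<Rightarrow> real"
  assumes g: "integrable lborel g" "\<And>x. 0 \<le> g x" "integral\<^sup>L lborel g = 1"
    and h: "integrable lborel h" "\<And>x. 0 \<le> h x" "integral\<^sup>L lborel h = 1" and t: "0 < t"
  shows "(\<integral>x. \<bar>g x - h x\<bar> \<partial>lborel) \<le> (\<integral>x. (sqrt (g x) - sqrt (h x))\<^sup>2 \<partial>lborel) / (2 * t) + 2 * t"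
proof -
  let ?H = "\<lambda>x. (sqrt (g x) - sqrt (h x))\<^sup>2"
  have [measurable]: "g \<in> borel_measurable borel" "h \<in> borel_measurable borel"
    using g(1) h(1) by auto
  have iH: "integrable lborel ?H"
  proof -
    have "integrable lborel (\<lambda>y. g y + h y)" using g(1) h(1) by simp
    then show ?thesis
    proof (rule Bochner_Integration.integrable_bound)
      have "(sqrt (g y) - sqrt (h y))\<^sup>2 \<le> g y + h y" for y
        using g(2) h(2) by (simp add: power2_diff)
      then show "AE y in lborel. norm (?H y) \<le> norm (g y + h y)"
        by (auto intro: order_trans[OF _ abs_ge_self])
    qed measurable
  qed
  have "\<bar>g x - h x\<bar> \<le> ?H x / (2 * t) + t * (g x + h x)" for x
  proof -
    let ?a = "\<bar>sqrt (g x) - sqrt (h x)\<bar>" and ?b = "sqrt (g x) + sqrt (h x)"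
    have "g x - h x = (sqrt (g x))\<^sup>2 - (sqrt (h x))\<^sup>2" using g(2) h(2) by simp
    then have "g x - h x = (sqrt (g x) - sqrt (h x)) * ?b" by (simp add: power2_eq_square algebra_simps)
    then have eq: "\<bar>g x - h x\<bar> = ?a * ?b" using g(2) h(2) by (simp add: abs_mult)
    have "2 * t * (a * b) \<le> a\<^sup>2 + t\<^sup>2 * b\<^sup>2" for a b :: real
      using zero_le_power2[of "a - t * b"] by (simp add: power2_eq_square algebra_simps)
    then have "2 * t * (?a * ?b) \<le> ?a\<^sup>2 + t\<^sup>2 * ?b\<^sup>2" .
    moreover have "?b\<^sup>2 \<le> 2 * (g x + h x)"
    proof -
      have "0 \<le> (sqrt (g x) - sqrt (h x))\<^sup>2" by simp
      then show ?thesis using g(2) h(2) by (simp add: power2_diff power2_sum)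
    qed
    then have "t\<^sup>2 * ?b\<^sup>2 \<le> t\<^sup>2 * (2 * (g x + h x))" by (rule mult_left_mono) simp
    ultimately have "2 * t * (?a * ?b) \<le> ?a\<^sup>2 + t\<^sup>2 * (2 * (g x + h x))" by linarith
    then have "?a * ?b \<le> (?a\<^sup>2 + t\<^sup>2 * (2 * (g x + h x))) / (2 * t)"
      using t by (simp add: pos_le_divide_eq mult.commute mult.left_commute)
    also have "\<dots> = ?H x / (2 * t) + t * (g x + h x)"
      using t by (simp add: field_simps power2_eq_square)
    finally show ?thesis unfolding eq .
  qed
  then have "(\<integral>x. \<bar>g x - h x\<bar> \<partial>lborel) \<le> (\<integral>x. ?H x / (2 * t) + t * (g x + h x) \<partial>lborel)"
    using g(1) h(1) iH by (intro integral_mono) auto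
  also have "\<dots> = integral\<^sup>L lborel ?H / (2 * t) + 2 * t"
    using g h iH by simp
  finally show ?thesis .
qed

definition near_truth :: "real \<Rightarrow> real \<Rightarrow> real \<Rightarrow> real \<Rightarrow> (real \<Rightarrow> real) \<Rightarrow>
    nat \<Rightarrow> (nat \<Rightarrow> real) \<Rightarrow> real \<Rightarrow> real \<Rightarrow> real \<Rightarrow> bool" where
  "near_truth d p0 v1 v2 g0 n x p u1 u2 \<longleftrightarrow>
     \<bar>p - p0\<bar> \<le> d \<and> \<bar>u1 - v1\<bar> \<le> d \<and> \<bar>u2 - v2\<bar> \<le> d \<and>
     lower_close d (empirical n x) (density lborel (\<lambda>y. ennreal (g0 y))) \<and>
     (\<forall>i\<in>{1..n}. 0 < g0 (x i)) \<and>
     (\<integral>y. g0 y * ln (g0 y) \<partial>lborel) - d \<le> (1 / real n) * (\<Sum>i=1..n. ln (g0 (x i)))"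

text \<open>Consistency in deterministic form. The order of the choices in the proof is essential: the
  bound \<open>K\<close> on the peak depends on the true law only, then \<open>c\<close> is chosen by \<open>\<epsilon>\<close>, and \<open>d\<close> comes last.\<close>

lemma maximizer_L1_close:
  fixes v1 v2 :: real
  assumes \<psi>0: "\<psi>0 \<in> SC" and f0: "f0 = (\<lambda>y. exp_ext (\<psi>0 y))" "elc_density f0"
    and p0: "0 < p0" "p0 < 1" "p0 \<noteq> 1 / 2" and \<epsilon>: "0 < \<epsilon>"
  defines "g0 \<equiv> mixture p0 v1 v2 f0"
  shows "\<exists>d>0. \<forall>n\<ge>1. \<forall>x p u1 u2 \<psi>. near_truth d p0 v1 v2 g0 n x p u1 u2 \<longrightarrow>
      is_arg_max (Phi n x p u1 u2) (\<lambda>\<psi>. \<psi> \<in> SC) \<psi> \<longrightarrow>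
      elc_density (\<lambda>y. exp_ext (\<psi> y)) \<and> (\<integral>y. \<bar>exp_ext (\<psi> y) - f0 y\<bar> \<partial>lborel) \<le> \<epsilon>"
proof -
  define E where "E = (\<integral>y. g0 y * ln (g0 y) \<partial>lborel)"
  define S where "S = (\<integral>y. sqrt (g0 y) \<partial>lborel)"
  define k where "k = min p0 (1 - p0)"
  define q where "q = \<bar>2 * p0 - 1\<bar>"
  define F where "F = f0 0"
  have p01: "0 \<le> p0" "p0 \<le> 1" using p0 by auto
  have k: "0 < k" "k \<le> 1" and q: "0 < q" and F: "0 < F"
    using p0 elcd_pos_0[OF f0(2)] by (auto simp: k_def q_def F_def)
  have S0: "0 \<le> S"
    unfolding S_def g0_def using mixture_nonneg[OF f0(2) p01] by (intro Bochner_Integration.integral_nonneg) auto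
  \<comment> \<open>The loss in log-likelihood of the competitor is at most \<open>C1 * d\<close>.\<close>
  define C1 where "C1 = 1 + 2 / k + 2 * F"
  have C1: "1 \<le> C1" using k F by (simp add: C1_def)
  \<comment> \<open>With this radius at most a quarter of the sample lies near the two centres.\<close>
  define r where "r = 1 / (64 * F)"
  have r: "0 < r" using F by (simp add: r_def)
  define K where "K = max (1 / r) (exp (- 2 * (E - 1) - 3 * ln r))"
  have K: "0 < K" using r by (simp add: K_def less_max_iff_disj)
  \<comment> \<open>The distance of the mixtures will be at most \<open>3 * \<eta>\<close>, and it is at least \<open>q / 2\<close> times the
    distance of \<open>f\<close> and \<open>f0\<close>.\<close>
  define \<eta> where "\<eta> = q * \<epsilon> / 8"
  have \<eta>: "0 < \<eta>" using q \<epsilon> by (simp add: \<eta>_def)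
  \<comment> \<open>With this \<open>c\<close> the regularization costs at most half of the squared distance \<open>\<eta>\<^sup>2\<close>.\<close>
  define c where "c = (\<eta>\<^sup>2 / (4 * (S + 1)))\<^sup>2"
  have c: "0 < c" using \<eta> S0 by (simp add: c_def)
  have cS: "2 * sqrt c * S \<le> \<eta>\<^sup>2 / 2"
  proof -
    have "0 \<le> \<eta>\<^sup>2 / (4 * (S + 1))" using S0 by simp
    then have "sqrt c = \<eta>\<^sup>2 / (4 * (S + 1))"
      unfolding c_def by (simp only: real_sqrt_abs abs_of_nonneg)
    then have "2 * sqrt c * S = (\<eta>\<^sup>2 / 2) * (S / (S + 1))"
      using \<eta> S0 by (simp add: field_simps)
    also have "\<dots> \<le> (\<eta>\<^sup>2 / 2) * 1" using S0 by (intro mult_left_mono) auto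
    finally show ?thesis by simp
  qed
  \<comment> \<open>The factor of \<open>d\<close> in \<open>likelihood_hellinger\<close>.\<close>
  define W where "W = ln (K + c) - ln c + 4 * K / c"
  have W: "0 \<le> W" using K c by (simp add: W_def)
  define d where "d = Min {k / 2, 1 / C1, r, 1 / 32, q / 4, \<eta> / (2 + 8 * F), \<eta>\<^sup>2 / 2 / (C1 + W)}"
  have d0: "0 < d" unfolding d_def using k C1 r q \<eta> F W by simp
  have dle: "d \<le> k / 2" "d \<le> 1 / C1" "d \<le> r" "d \<le> 1 / 32" "d \<le> q / 4" "d \<le> \<eta> / (2 + 8 * F)" "d \<le> \<eta>\<^sup>2 / 2 / (C1 + W)"
    unfolding d_def by (intro Min_le; simp)+
  have dC1: "d * C1 \<le> 1" and dF: "(2 + 8 * F) * d \<le> \<eta>" and dW: "d * C1 + W * d \<le> \<eta>\<^sup>2 / 2"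
    using dle C1 F W by (simp_all add: pos_le_divide_eq algebra_simps)
  have main: "elc_density f \<and> (\<integral>y. \<bar>f y - f0 y\<bar> \<partial>lborel) \<le> \<epsilon>"
    if n: "1 \<le> n" and p: "\<bar>p - p0\<bar> \<le> d" and u: "\<bar>u1 - v1\<bar> \<le> d" "\<bar>u2 - v2\<bar> \<le> d"
      and close: "lower_close d (empirical n x) (density lborel (\<lambda>y. ennreal (g0 y)))"
      and pos: "\<And>i. i \<in> {1..n} \<Longrightarrow> 0 < g0 (x i)"
      and lik: "E - d \<le> (1 / real n) * (\<Sum>i=1..n. ln (g0 (x i)))"
      and max: "is_arg_max (Phi n x p u1 u2) (\<lambda>\<psi>. \<psi> \<in> SC) \<psi>" and f: "f = (\<lambda>y. exp_ext (\<psi> y))"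
    for n x p u1 u2 \<psi> f
  proof -
    have pp: "0 \<le> p" "p \<le> 1" using p dle(1) k by (auto simp: k_def)
    have dk: "d < k" using dle(1) k by linarith
    note bi = basic_inequality[OF \<psi>0 f0 p0(1,2) k_def dk p u n pos[unfolded g0_def] max f]
    have e: "elc_density f" by (rule bi(1))
    let ?g = "mixture p u1 u2 f"
    let ?L = "(1 / real n) * (\<Sum>i=1..n. ln (?g (x i)))"
    have "d / k \<le> 1 / 2" "0 \<le> d / k" using dle(1) k d0 by (auto simp: field_simps)
    then have "- (2 * (d / k)) \<le> ln (1 - d / k)"
      using ln_one_minus_pos_lower_bound[of "d / k"] mult_left_mono[of "d / k" "1 / 2" "2 * (d / k)"]
      by (simp add: power2_eq_square)
    then have L: "E - d * C1 \<le> ?L"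
      using bi(3) lik by (simp add: g0_def C1_def F_def algebra_simps)
    have "f 0 \<le> max (1 / r) (exp (- 2 * (E - 1) - 3 * ln r))"
    proof (rule peak_bound[OF e pp r n bi(2)])
      let ?I1 = "{v1 - 2 * r..v1 + 2 * r}" and ?I2 = "{v2 - 2 * r..v2 + 2 * r}"
      let ?G = "density lborel (\<lambda>y. ennreal (g0 y))"
      show "?I1 \<union> ?I2 \<in> sets borel" by simp
      show "{u1 - r..u1 + r} \<union> {u2 - r..u2 + r} \<subseteq> ?I1 \<union> ?I2" using u dle(3) by auto
      interpret G: prob_space ?G
        unfolding g0_def by (rule prob_space_mixture[OF f0(2) p01])
      interpret Q: prob_space "empirical n x" by (rule prob_space_empirical)
      have I: "measure (empirical n x) {v - 2 * r..v + 2 * r} \<le> 1 / 8" for v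
      proof -
        have "measure ?G {v - 2 * r..v + 2 * r} \<le> F * (4 * r)"
          using measure_mixture_interval_le[OF f0(2) p01, of "v - 2 * r" "v + 2 * r" v1 v2] r
          by (simp add: g0_def F_def)
        also have "\<dots> = 1 / 16" using F by (simp add: r_def)
        finally show ?thesis
          using lower_close_interval[OF prob_space_empirical G.prob_space_axioms sets_empirical _ close, of "v - 2 * r" "v + 2 * r"] dle(4) r
          by simp
      qed
      have "measure (empirical n x) (?I1 \<union> ?I2) \<le> measure (empirical n x) ?I1 + measure (empirical n x) ?I2"
        by (intro measure_Un_le) auto
      then show "measure (empirical n x) (?I1 \<union> ?I2) \<le> 1 / 4" using I[of v1] I[of v2] by simp
      show "E - 1 \<le> ?L" using L dC1 by linarith
    qed
    then have fK: "f 0 \<le> K" by (simp add: K_def)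
    have "(\<integral>y. (sqrt (?g y) - sqrt (g0 y))\<^sup>2 \<partial>lborel) \<le> d * C1 + W * d + 2 * sqrt c * S"
      unfolding g0_def W_def S_def
      by (rule likelihood_hellinger[OF e f0(2) pp p01 c n _ fK])
         (use d0 close bi(2) L in \<open>auto simp: g0_def E_def\<close>)
    also have "\<dots> \<le> \<eta>\<^sup>2" using dW cS by linarith
    finally have H: "(\<integral>y. (sqrt (?g y) - sqrt (g0 y))\<^sup>2 \<partial>lborel) \<le> \<eta>\<^sup>2" .
    have "(\<integral>y. \<bar>?g y - g0 y\<bar> \<partial>lborel) \<le> (\<integral>y. (sqrt (?g y) - sqrt (g0 y))\<^sup>2 \<partial>lborel) / (2 * (\<eta> / 2)) + 2 * (\<eta> / 2)"
      unfolding g0_def using \<eta>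
      by (intro L1_le_hellinger mixture_integrable mixture_nonneg mixture_integral e f0(2) pp p01) auto
    also have "\<dots> \<le> \<eta>\<^sup>2 / \<eta> + \<eta>" using H \<eta> by (simp add: divide_right_mono)
    finally have 1: "(\<integral>y. \<bar>?g y - g0 y\<bar> \<partial>lborel) \<le> 2 * \<eta>" using \<eta> by (simp add: power2_eq_square)
    have 2: "(\<integral>y. \<bar>mixture p u1 u2 f0 y - g0 y\<bar> \<partial>lborel) \<le> \<eta>"
    proof -
      have "(\<integral>y. \<bar>mixture p u1 u2 f0 y - g0 y\<bar> \<partial>lborel)
          \<le> 2 * \<bar>p - p0\<bar> + 4 * F * (\<bar>u1 - v1\<bar> + \<bar>u2 - v2\<bar>)"
        unfolding g0_def F_def by (rule mixture_parameter_L1[OF f0(2) pp p01])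
      also have "\<dots> \<le> 2 * d + 4 * F * (d + d)"
        using p u F by (intro add_mono mult_left_mono) auto
      also have "\<dots> = (2 + 8 * F) * d" by (simp add: algebra_simps)
      finally show ?thesis using dF by linarith
    qed
    let ?D = "\<integral>y. \<bar>f y - f0 y\<bar> \<partial>lborel"
    have i: "integrable lborel ?g" "integrable lborel g0" "integrable lborel (mixture p u1 u2 f0)"
      unfolding g0_def by (intro mixture_integrable e f0(2) pp p01)+
    have "q \<le> \<bar>2 * p - 1\<bar> + 2 * d" using p unfolding q_def by linarith
    then have "q / 2 \<le> \<bar>2 * p - 1\<bar>" using dle(5) by simp
    then have "q / 2 * ?D \<le> \<bar>2 * p - 1\<bar> * ?D"
      by (intro mult_right_mono Bochner_Integration.integral_nonneg) auto
    also have "\<dots> \<le> (\<integral>y. \<bar>?g y - mixture p u1 u2 f0 y\<bar> \<partial>lborel)"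
      by (rule mixture_L1_lower[OF e f0(2) pp])
    also have "\<dots> \<le> (\<integral>y. \<bar>?g y - g0 y\<bar> + \<bar>mixture p u1 u2 f0 y - g0 y\<bar> \<partial>lborel)"
      using i by (intro integral_mono) auto
    also have "\<dots> \<le> 3 * \<eta>" using 1 2 i by simp
    also have "\<dots> \<le> 4 * \<eta>" using \<eta> by simp
    also have "\<dots> = q / 2 * \<epsilon>" by (simp add: \<eta>_def)
    finally have "?D \<le> \<epsilon>" using q by simp
    then show ?thesis using e by simp
  qed
  show ?thesis
  proof (rule exI[of _ d], intro conjI[OF d0] allI impI)
    fix n x p u1 u2 \<psi>
    assume "1 \<le> n" and near: "near_truth d p0 v1 v2 g0 n x p u1 u2"
      and max: "is_arg_max (Phi n x p u1 u2) (\<lambda>\<psi>. \<psi> \<in> SC) \<psi>"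
    show "elc_density (\<lambda>y. exp_ext (\<psi> y)) \<and> (\<integral>y. \<bar>exp_ext (\<psi> y) - f0 y\<bar> \<partial>lborel) \<le> \<epsilon>"
    proof (rule main[OF \<open>1 \<le> n\<close> _ _ _ _ _ _ max refl])
      show "\<bar>p - p0\<bar> \<le> d" "\<bar>u1 - v1\<bar> \<le> d" "\<bar>u2 - v2\<bar> \<le> d"
        "lower_close d (empirical n x) (density lborel (\<lambda>y. ennreal (g0 y)))"
        "E - d \<le> (1 / real n) * (\<Sum>i=1..n. ln (g0 (x i)))"
        using near by (simp_all only: near_truth_def E_def)
      show "0 < g0 (x i)" if "i \<in> {1..n}" for i
        using near that by (simp only: near_truth_def)
    qed
  qed
qed

section \<open>Consequences of closeness in total variation\<close>

text \<open>Densities in the class are monotone on the half-line, so closeness in \<open>L\<^sup>1\<close> yields pointwise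
  bounds after a shift of the argument.\<close>

lemma L1_shift_le:
  assumes f: "elc_density f" and f': "elc_density f'"
    and D: "(\<integral>x. \<bar>f x - f' x\<bar> \<partial>lborel) \<le> d" and y: "0 \<le> y" and h: "0 < h"
  shows "f (y + h) \<le> f' y + d / h"
proof -
  have "(\<integral>z. indicator {y..y + h} z * (f (y + h) - f' y) \<partial>lborel) \<le> (\<integral>x. \<bar>f x - f' x\<bar> \<partial>lborel)"
  proof (rule integral_mono)
    show "integrable lborel (\<lambda>z. indicator {y..y + h} z * (f (y + h) - f' y))"
      by (intro integrable_mult_left integrable_real_indicator) (auto simp: emeasure_lborel_Icc_eq)
    show "integrable lborel (\<lambda>x. \<bar>f x - f' x\<bar>)"
      using elcd_integrable[OF f] elcd_integrable[OF f'] by simp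
    show "indicator {y..y + h} z * (f (y + h) - f' y) \<le> \<bar>f z - f' z\<bar>" for z
    proof (cases "z \<in> {y..y + h}")
      case True
      then have "f (y + h) \<le> f z" "f' z \<le> f' y"
        using y by (intro elc_antimono_abs[OF elcd_elc[OF f]] elc_antimono_abs[OF elcd_elc[OF f']]; simp)+
      then show ?thesis using True by simp
    qed simp
  qed
  then have "h * (f (y + h) - f' y) \<le> d" using h D by simp
  then show ?thesis using h by (simp add: field_simps)
qed

lemma L1_commute: "(\<integral>x. \<bar>f x - g x\<bar> \<partial>lborel) = (\<integral>x. \<bar>g x - f x\<bar> \<partial>lborel)" for f g :: "real \<Rightarrow> real"
  by (simp add: abs_minus_commute)

text \<open>The peak is not controlled by monotonicity alone; the bound comes from
  \<open>f 0 * f (2 * h) \<le> (f h)\<^sup>2\<close>.\<close>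

lemma L1_peak_le:
  assumes f: "elc_density f" and f0: "elc_density f0"
    and D: "(\<integral>x. \<bar>f x - f0 x\<bar> \<partial>lborel) \<le> d" and h: "0 < h" and pos: "d / h < f0 (3 * h)"
  shows "f 0 \<le> (f0 0 + d / h)\<^sup>2 / (f0 (3 * h) - d / h)"
proof -
  note e = elcd_elc[OF f]
  have "f h \<le> f0 0 + d / h" using L1_shift_le[OF f f0 D, of 0 h] h by simp
  then have "(f h)\<^sup>2 \<le> (f0 0 + d / h)\<^sup>2" using elc_nonneg[OF e] by (intro power_mono)
  moreover have "f0 (3 * h) - d / h \<le> f (2 * h)"
    using L1_shift_le[OF f0 f _ _ h, of d "2 * h"] D h by (simp add: L1_commute[of f0])
  then have "f 0 * (f0 (3 * h) - d / h) \<le> f 0 * f (2 * h)"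
    using elc_nonneg[OF e] by (intro mult_left_mono)
  ultimately have "f 0 * (f0 (3 * h) - d / h) \<le> (f0 0 + d / h)\<^sup>2"
    using elc_midpoint[OF e, of h] by linarith
  then show ?thesis using pos by (simp add: pos_le_divide_eq)
qed

text \<open>A common exponential envelope: the exponential rate of \<open>f0\<close> is inherited, up to an
  arbitrarily small loss, by all densities in an \<open>L\<^sup>1\<close> neighbourhood, because the chord of the
  logarithm between \<open>0\<close> and a distant point has almost the right slope.\<close>

lemma L1_exp_envelope:
  assumes f0: "elc_density f0" and b: "\<And>x. f0 x \<le> exp (- a0 * x + b)" and a: "0 < a" "a < a0"
  shows "\<exists>d>0. \<exists>B>0. \<forall>f. elc_density f \<longrightarrow> (\<integral>x. \<bar>f x - f0 x\<bar> \<partial>lborel) \<le> d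
    \<longrightarrow> (\<forall>x. f x \<le> B * exp (- a * \<bar>x\<bar>))"
proof -
  obtain h' where "0 < h'" "0 < f0 h'" using elcd_pos_at[OF f0] by blast
  \<comment> \<open>The bound on the peak evaluates \<open>f0\<close> at \<open>3 * h\<close>.\<close>
  define h where "h = h' / 3"
  define m where "m = f0 (3 * h)"
  have h: "0 < h" and m: "0 < m" using \<open>0 < h'\<close> \<open>0 < f0 h'\<close> by (auto simp: h_def m_def)
  \<comment> \<open>At \<open>y\<close> the bound \<open>2 * exp (- a0 * (y - 1) + b)\<close> for \<open>f\<close> has dropped below
    \<open>(m / 2) * exp (- a * y)\<close>, while \<open>f 0 \<ge> m / 2\<close>.\<close>
  define y where "y = max 1 ((ln (4 / m) + a0 + b) / (a0 - a))"
  have y: "1 \<le> y" "ln (4 / m) + a0 + b \<le> (a0 - a) * y"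
  proof -
    have "(ln (4 / m) + a0 + b) / (a0 - a) \<le> y" by (simp add: y_def)
    then show "ln (4 / m) + a0 + b \<le> (a0 - a) * y" using a by (simp add: pos_divide_le_eq mult.commute)
  qed (simp add: y_def)
  define t where "t = exp (- a0 * (y - 1) + b)"
  define d where "d = min (h * m / 2) t"
  define P where "P = (f0 0 + d / h)\<^sup>2 / (f0 (3 * h) - d / h)"
  have d: "0 < d" "d \<le> t" "d / h \<le> m / 2"
  proof -
    show "0 < d" "d \<le> t" using h m by (simp_all add: d_def t_def)
    have "d \<le> h * m / 2" by (simp add: d_def)
    then show "d / h \<le> m / 2" using h by (simp add: pos_divide_le_eq mult.commute)
  qed
  have dh: "d / h < f0 (3 * h)" using d(3) m unfolding m_def[symmetric] by linarith
  have "0 < d / h" "0 < f0 (3 * h) - d / h" using d(1) h dh by simp_all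
  then have P: "0 < P"
    unfolding P_def using elcd_pos_0[OF f0]
    by (intro divide_pos_pos[of "(f0 0 + d / h)\<^sup>2"] zero_less_power add_pos_pos)
  have "f x \<le> P * exp (a * y) * exp (- a * \<bar>x\<bar>)"
    if f: "elc_density f" and D: "(\<integral>x. \<bar>f x - f0 x\<bar> \<partial>lborel) \<le> d" for f x
  proof -
    note e = elcd_elc[OF f]
    have fP: "f 0 \<le> P" unfolding P_def by (rule L1_peak_le[OF f f0 D h dh])
    have "f0 (3 * h) - d / h \<le> f (2 * h)"
      using L1_shift_le[OF f0 f _ _ h, of d "2 * h"] D h by (simp add: L1_commute[of f0])
    then have m2: "m / 2 \<le> f 0" using elc_le_0[OF e, of "2 * h"] d(3) unfolding m_def by linarith
    have "f y \<le> f0 (y - 1) + d"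
      using L1_shift_le[OF f f0 D, of "y - 1" 1] y by simp
    also have "\<dots> \<le> 2 * t" using b[of "y - 1"] d(2) unfolding t_def by linarith
    also have "\<dots> \<le> m / 2 * exp (- a * y)"
    proof -
      have "ln (4 / m) + (- a0 * (y - 1) + b) \<le> - a * y" using y(2) by (simp add: algebra_simps)
      then have "exp (ln (4 / m) + (- a0 * (y - 1) + b)) \<le> exp (- a * y)" by simp
      then have "4 / m * t \<le> exp (- a * y)" using m by (simp add: exp_add t_def)
      then show ?thesis using m by (simp add: field_simps)
    qed
    also have "\<dots> \<le> f 0 * exp (- a * y)" using m2 by (intro mult_right_mono) auto
    finally have fy: "f y \<le> f 0 * exp (- a * y)" .
    show ?thesis
    proof (cases "y \<le> \<bar>x\<bar>")
      case True
      have "f x \<le> f 0 * exp (- a * \<bar>x\<bar>)"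
        using elc_exp_tail[OF e _ fy True] y elc_abs[OF e] by simp
      also have "\<dots> \<le> P * exp (a * y) * exp (- a * \<bar>x\<bar>)"
        using fP P a y by (intro mult_right_mono order_trans[OF fP]) auto
      finally show ?thesis .
    next
      case False
      have "f x \<le> P * 1" using elc_le_0[OF e, of x] fP by simp
      also have "\<dots> \<le> P * (exp (a * y) * exp (- a * \<bar>x\<bar>))"
        using False P a by (intro mult_left_mono) (auto simp flip: exp_add)
      finally show ?thesis by (simp add: mult.assoc)
    qed
  qed
  moreover have "0 < P * exp (a * y)" using P by simp
  ultimately show ?thesis using d(1) by blast
qed

lemma weighted_tail_le:
  assumes f: "elc_density f" "\<And>x. f x \<le> B * exp (- a' * \<bar>x\<bar>)"
    and f0: "elc_density f0" "\<And>x. f0 x \<le> B * exp (- a' * \<bar>x\<bar>)" and a: "0 < a"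
  shows "exp (a * t) * \<bar>f t - f0 t\<bar> \<le> B * exp (- (a' - a) * \<bar>t\<bar>)"
proof -
  have "\<bar>f t - f0 t\<bar> \<le> B * exp (- a' * \<bar>t\<bar>)"
    using f(2)[of t] f0(2)[of t] elc_nonneg[OF elcd_elc, OF f(1), of t] elc_nonneg[OF elcd_elc, OF f0(1), of t]
    by linarith
  moreover have "a * t \<le> a * \<bar>t\<bar>" using a by simp
  then have "exp (a * t) \<le> exp (a * \<bar>t\<bar>)" by simp
  ultimately have "exp (a * t) * \<bar>f t - f0 t\<bar> \<le> exp (a * \<bar>t\<bar>) * (B * exp (- a' * \<bar>t\<bar>))"
    by (intro mult_mono) auto
  also have "\<dots> = B * exp (- (a' - a) * \<bar>t\<bar>)"
    by (simp add: algebra_simps flip: exp_add)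
  finally show ?thesis .
qed

lemma exp_decay_small:
  fixes B s \<epsilon> :: real
  assumes "0 < s" "0 < \<epsilon>"
  shows "\<exists>T>0. B * exp (- s * T) \<le> \<epsilon>"
proof -
  have "((\<lambda>T. B * exp (- s * T)) \<longlongrightarrow> 0) at_top"
    using assms(1) by real_asymp
  then have "\<forall>\<^sub>F T in at_top. B * exp (- s * T) < \<epsilon>"
    using assms(2) by (rule order_tendstoD)
  moreover have "\<forall>\<^sub>F T in at_top. (0::real) < T" by (rule eventually_gt_at_top)
  ultimately have "\<forall>\<^sub>F T in at_top. 0 < T \<and> B * exp (- s * T) < \<epsilon>"
    by eventually_elim simp
  then show ?thesis by (auto dest!: eventually_happens intro: less_imp_le)
qed

text \<open>The common envelope with a rate strictly between \<open>a\<close> and \<open>a0\<close> makes the tails uniformly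
  small, and on a bounded interval the weight is bounded.\<close>

lemma weighted_L1_close:
  assumes f0: "elc_density f0" and b: "\<And>x. f0 x \<le> exp (- a0 * x + b)" and a: "0 < a" "a < a0" and \<epsilon>: "0 < \<epsilon>"
  shows "\<exists>d>0. \<forall>f. elc_density f \<longrightarrow> (\<integral>x. \<bar>f x - f0 x\<bar> \<partial>lborel) \<le> d
    \<longrightarrow> (\<integral>\<^sup>+t. ennreal (exp (a * t) * \<bar>f t - f0 t\<bar>) \<partial>lborel) \<le> ennreal \<epsilon>"
proof -
  define a' where "a' = (a + a0) / 2"
  define s where "s = (a' - a) / 2"
  have a': "0 < a'" "a' < a0" and s: "0 < s" using a by (auto simp: a'_def s_def)
  obtain d1 B where d1: "0 < d1" and B: "0 < B"
    and env: "\<And>f x. elc_density f \<Longrightarrow> (\<integral>x. \<bar>f x - f0 x\<bar> \<partial>lborel) \<le> d1 \<Longrightarrow> f x \<le> B * exp (- a' * \<bar>x\<bar>)"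
    using L1_exp_envelope[OF f0 b a'] by blast
  have env0: "f0 x \<le> B * exp (- a' * \<bar>x\<bar>)" for x using env[OF f0] d1 by simp
  define J where "J = (\<integral>t. exp (- s * \<bar>t\<bar>) \<partial>lborel)"
  have J: "0 \<le> J" unfolding J_def by (intro Bochner_Integration.integral_nonneg) auto
  obtain T where T: "0 < T" and tail: "(B * J) * exp (- s * T) \<le> \<epsilon> / 2"
    using exp_decay_small[OF s, of "\<epsilon> / 2" "B * J"] \<epsilon> by auto
  define d where "d = min d1 (\<epsilon> / 2 * exp (- a * T))"
  have d: "0 < d" "d \<le> d1" "exp (a * T) * d \<le> \<epsilon> / 2"
  proof -
    show "0 < d" "d \<le> d1" using d1 \<epsilon> by (auto simp: d_def)
    have "exp (a * T) * d \<le> exp (a * T) * (\<epsilon> / 2 * exp (- a * T))" by (intro mult_left_mono) (auto simp: d_def)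
    also have "\<dots> = \<epsilon> / 2 * exp (a * T + - a * T)" unfolding exp_add by simp
    finally show "exp (a * T) * d \<le> \<epsilon> / 2" by simp
  qed
  have "(\<integral>\<^sup>+t. ennreal (exp (a * t) * \<bar>f t - f0 t\<bar>) \<partial>lborel) \<le> ennreal \<epsilon>"
    if f: "elc_density f" and D: "(\<integral>x. \<bar>f x - f0 x\<bar> \<partial>lborel) \<le> d" for f
  proof -
    let ?R = "\<lambda>t. exp (a * T) * \<bar>f t - f0 t\<bar> + B * exp (- s * T) * exp (- s * \<bar>t\<bar>)"
    have pt: "exp (a * t) * \<bar>f t - f0 t\<bar> \<le> ?R t" for t
    proof (cases "\<bar>t\<bar> \<le> T")
      case True
      then have "exp (a * t) \<le> exp (a * T)" using a by simp
      then have "exp (a * t) * \<bar>f t - f0 t\<bar> \<le> exp (a * T) * \<bar>f t - f0 t\<bar>" by (rule mult_right_mono) simp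
      then show ?thesis using B by (simp add: add_increasing2)
    next
      case False
      have "exp (a * t) * \<bar>f t - f0 t\<bar> \<le> B * exp (- (a' - a) * \<bar>t\<bar>)"
        using weighted_tail_le[OF f env[OF f] f0 env0 a(1)] D d(2) by simp
      also have "\<dots> \<le> B * exp (- s * T + - s * \<bar>t\<bar>)"
      proof -
        have "s * T \<le> s * \<bar>t\<bar>" using False s by (intro mult_left_mono) auto
        moreover have eq: "a' - a = 2 * s" by (simp add: s_def)
        ultimately have "- (a' - a) * \<bar>t\<bar> \<le> - s * T + - s * \<bar>t\<bar>"
          unfolding eq by linarith
        then show ?thesis using B by (intro mult_left_mono) simp_all
      qed
      also have "\<dots> = B * exp (- s * T) * exp (- s * \<bar>t\<bar>)"
        unfolding exp_add by (rule mult.assoc[symmetric])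
      also have "\<dots> \<le> ?R t" by simp
      finally show ?thesis .
    qed
    have iR: "integrable lborel ?R"
      using elcd_integrable[OF f] elcd_integrable[OF f0(1)] exp_abs_integrable[OF s] by simp
    have "(\<integral>\<^sup>+t. ennreal (exp (a * t) * \<bar>f t - f0 t\<bar>) \<partial>lborel) \<le> (\<integral>\<^sup>+t. ennreal (?R t) \<partial>lborel)"
      using pt by (intro nn_integral_mono ennreal_leI) auto
    also have "\<dots> = ennreal (integral\<^sup>L lborel ?R)"
      using iR B by (intro nn_integral_eq_integral) auto
    also have "integral\<^sup>L lborel ?R = exp (a * T) * (\<integral>x. \<bar>f x - f0 x\<bar> \<partial>lborel) + B * exp (- s * T) * J"
      using elcd_integrable[OF f] elcd_integrable[OF f0(1)] exp_abs_integrable[OF s] by (simp add: J_def)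
    also have "\<dots> \<le> exp (a * T) * d + B * exp (- s * T) * J"
      using D by simp
    also have "\<dots> \<le> \<epsilon>" using d(3) tail by (simp add: mult.commute mult.left_commute)
    finally show ?thesis by (simp add: ennreal_leI)
  qed
  then show ?thesis using d(1) by blast
qed

text \<open>Uniform closeness on an interval of continuity. Monotonicity and continuity of \<open>f0\<close> absorb
  the shifts, and continuity at the endpoint \<open>A\<close> is used from both sides.\<close>

lemma uniform_close:
  assumes f0: "elc_density f0" and A: "0 < A" and cont: "\<And>t. \<bar>t\<bar> \<le> A \<Longrightarrow> isCont f0 t" and \<epsilon>: "0 < \<epsilon>"
  shows "\<exists>d>0. \<forall>f. elc_density f \<longrightarrow> (\<integral>x. \<bar>f x - f0 x\<bar> \<partial>lborel) \<le> d \<longrightarrow> (\<forall>t. \<bar>t\<bar> \<le> A \<longrightarrow> \<bar>f t - f0 t\<bar> \<le> \<epsilon>)"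
proof -
  note e0 = elcd_elc[OF f0]
  have "uniformly_continuous_on {0..A} f0"
    using cont by (intro compact_uniformly_continuous continuous_at_imp_continuous_on) auto
  then obtain r1 where r1: "0 < r1"
    and uc: "\<And>x y. x \<in> {0..A} \<Longrightarrow> y \<in> {0..A} \<Longrightarrow> dist y x < r1 \<Longrightarrow> dist (f0 y) (f0 x) < \<epsilon> / 4"
    using \<epsilon> unfolding uniformly_continuous_on_def by (metis divide_pos_pos zero_less_numeral)
  have "isCont f0 A" using cont A by simp
  then obtain r2 where r2: "0 < r2" and cA: "\<And>y. dist y A < r2 \<Longrightarrow> dist (f0 y) (f0 A) < \<epsilon> / 4"
    using \<epsilon> unfolding continuous_at_eps_delta by (metis divide_pos_pos zero_less_numeral dist_real_def)
  define h1 where "h1 = min (min r1 r2) A / 2"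
  have h1: "0 < h1" "h1 < r1" "h1 < r2" "h1 < A" using r1 r2 A by (auto simp: h1_def min_def)
  have shift: "f0 x - f0 (x + h1) \<le> \<epsilon> / 2" if x: "0 \<le> x" "x \<le> A" for x
  proof (cases "x + h1 \<le> A")
    case True
    then have "dist (f0 (x + h1)) (f0 x) < \<epsilon> / 4" using x h1 by (intro uc) (auto simp: dist_real_def)
    then show ?thesis using \<epsilon> unfolding dist_real_def by linarith
  next
    case False
    have "f0 x \<le> f0 (A - h1)" "f0 (A + h1) \<le> f0 (x + h1)"
      using False x h1 by (auto intro!: elc_antimono_abs[OF e0])
    moreover have "dist (f0 (A - h1)) (f0 A) < \<epsilon> / 4" "dist (f0 (A + h1)) (f0 A) < \<epsilon> / 4"
      using h1 by (intro cA; simp add: dist_real_def)+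
    ultimately show ?thesis unfolding dist_real_def by linarith
  qed
  \<comment> \<open>The second scale \<open>h2\<close> is chosen for the bound on the peak.\<close>
  have "((\<lambda>h. (f0 0)\<^sup>2 / f0 (3 * h)) \<longlongrightarrow> (f0 0)\<^sup>2 / f0 (3 * 0)) (at_right 0)"
  proof (intro tendsto_intros)
    have "isCont f0 (3 * 0)" using cont[of 0] A by simp
    moreover have "((\<lambda>h. 3 * h) \<longlongrightarrow> 3 * 0) (at_right (0::real))" by (intro tendsto_intros)
    ultimately show "((\<lambda>h. f0 (3 * h)) \<longlongrightarrow> f0 (3 * 0)) (at_right 0)" by (rule isCont_tendsto_compose)
    show "f0 (3 * 0) \<noteq> 0" using elcd_pos_0[OF f0] by simp
  qed
  moreover have "(f0 0)\<^sup>2 / f0 (3 * 0) < f0 0 + \<epsilon> / 4"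
    using elcd_pos_0[OF f0] \<epsilon> by (simp add: power2_eq_square)
  ultimately have "\<forall>\<^sub>F h in at_right 0. (f0 0)\<^sup>2 / f0 (3 * h) < f0 0 + \<epsilon> / 4"
    by (rule order_tendstoD)
  moreover have "\<forall>\<^sub>F h in at_right 0. 0 < f0 (3 * h)"
  proof -
    have "isCont f0 (3 * 0)" using cont[of 0] A by simp
    moreover have "((\<lambda>h. 3 * h) \<longlongrightarrow> 3 * 0) (at_right (0::real))" by (intro tendsto_intros)
    ultimately have "((\<lambda>h. f0 (3 * h)) \<longlongrightarrow> f0 (3 * 0)) (at_right 0)" by (rule isCont_tendsto_compose)
    then show ?thesis using elcd_pos_0[OF f0] by (intro order_tendstoD(1)) auto
  qed
  moreover have "\<forall>\<^sub>F h in at_right 0. (0::real) < h" by (rule eventually_at_right_less)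
  ultimately have "\<forall>\<^sub>F h in at_right 0. (f0 0)\<^sup>2 / f0 (3 * h) < f0 0 + \<epsilon> / 4 \<and> 0 < f0 (3 * h) \<and> 0 < h"
    by eventually_elim auto
  then obtain h2 where h2: "0 < h2" "0 < f0 (3 * h2)" "(f0 0)\<^sup>2 / f0 (3 * h2) < f0 0 + \<epsilon> / 4"
    using eventually_happens[of _ "at_right (0::real)"] by (auto simp: trivial_limit_at_right_real)
  have small: "\<forall>\<^sub>F d in at_right 0. d / h < c" if "0 < h" "0 < c" for h c :: real
  proof (rule order_tendstoD(2))
    show "((\<lambda>d. d / h) \<longlongrightarrow> 0 / h) (at_right 0)"
      using that by (intro tendsto_intros) auto
  qed (use that in simp)
  have "((\<lambda>d. (f0 0 + d / h2)\<^sup>2 / (f0 (3 * h2) - d / h2)) \<longlongrightarrow> (f0 0 + 0 / h2)\<^sup>2 / (f0 (3 * h2) - 0 / h2)) (at_right 0)"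
    using h2 by (intro tendsto_intros) auto
  then have "\<forall>\<^sub>F d in at_right 0. (f0 0 + d / h2)\<^sup>2 / (f0 (3 * h2) - d / h2) < f0 0 + \<epsilon> / 4"
    by (rule order_tendstoD) (use h2 in simp)
  moreover have "\<forall>\<^sub>F d in at_right 0. d / h2 < f0 (3 * h2)"
    by (rule small[OF h2(1,2)])
  moreover have "\<forall>\<^sub>F d in at_right 0. d / h1 < \<epsilon> / 4"
    by (rule small[OF h1(1)]) (use \<epsilon> in simp)
  moreover have "\<forall>\<^sub>F d in at_right 0. (0::real) < d" by (rule eventually_at_right_less)
  ultimately have "\<forall>\<^sub>F d in at_right 0. (f0 0 + d / h2)\<^sup>2 / (f0 (3 * h2) - d / h2) < f0 0 + \<epsilon> / 4
      \<and> d / h2 < f0 (3 * h2) \<and> d / h1 < \<epsilon> / 4 \<and> 0 < d"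
    by eventually_elim auto
  then obtain d where d: "0 < d" "d / h2 < f0 (3 * h2)" "d / h1 < \<epsilon> / 4"
      "(f0 0 + d / h2)\<^sup>2 / (f0 (3 * h2) - d / h2) < f0 0 + \<epsilon> / 4"
    using eventually_happens[of _ "at_right (0::real)"] by (auto simp: trivial_limit_at_right_real)
  have "\<bar>f t - f0 t\<bar> \<le> \<epsilon>"
    if f: "elc_density f" and D: "(\<integral>x. \<bar>f x - f0 x\<bar> \<partial>lborel) \<le> d" and t: "\<bar>t\<bar> \<le> A" for f t
  proof -
    note e = elcd_elc[OF f]
    let ?t = "\<bar>t\<bar>"
    have D': "(\<integral>x. \<bar>f0 x - f x\<bar> \<partial>lborel) \<le> d" using D by (simp add: L1_commute[of f0])
    have "f0 (?t + h1) \<le> f ?t + d / h1" using L1_shift_le[OF f0 f D' _ h1(1)] by simp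
    then have lower: "f0 ?t - f ?t \<le> \<epsilon>" using shift[of ?t] t d(3) \<epsilon> by linarith
    have upper: "f ?t - f0 ?t \<le> \<epsilon>"
    proof (cases "h1 \<le> ?t")
      case True
      then have "f ?t \<le> f0 (?t - h1) + d / h1" using L1_shift_le[OF f f0 D, of "?t - h1" h1] h1 by simp
      moreover have "f0 (?t - h1) - f0 ?t \<le> \<epsilon> / 2" using shift[of "?t - h1"] True t h1 by simp
      ultimately show ?thesis using d(3) \<epsilon> by linarith
    next
      case False
      have "f ?t \<le> f 0" by (rule elc_le_0[OF e])
      also have "f 0 \<le> f0 0 + \<epsilon> / 4"
        using L1_peak_le[OF f f0 D h2(1) d(2)] d(4) by linarith
      finally have "f ?t \<le> f0 0 + \<epsilon> / 4" .
      moreover have "f0 0 - f0 h1 \<le> \<epsilon> / 2" using shift[of 0] A by simp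
      moreover have "f0 h1 \<le> f0 ?t" using False h1 by (intro elc_antimono_abs[OF e0]) auto
      ultimately show ?thesis using \<epsilon> by linarith
    qed
    show ?thesis using lower upper elc_abs[OF e, of t] elc_abs[OF e0, of t] by simp
  qed
  then show ?thesis using d(1) by blast
qed

text \<open>For \<open>A = \<infinity>\<close> the envelope reduces the claim to a bounded interval \<open>[-T, T]\<close>.\<close>

lemma weighted_sup_close:
  fixes A :: ereal
  assumes f0: "elc_density f0" and b: "\<And>x. f0 x \<le> exp (- a0 * x + b)" and a: "0 < a" "a < a0" and \<epsilon>: "0 < \<epsilon>"
    and A: "0 < A" and cont: "\<And>t::real. - A \<le> ereal t \<Longrightarrow> ereal t \<le> A \<Longrightarrow> isCont f0 t"
  shows "\<exists>d>0. \<forall>f. elc_density f \<longrightarrow> (\<integral>x. \<bar>f x - f0 x\<bar> \<partial>lborel) \<le> d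
    \<longrightarrow> (SUP t\<in>{t::real. - A \<le> ereal t \<and> ereal t \<le> A}. ennreal (exp (a * t) * \<bar>f t - f0 t\<bar>)) \<le> ennreal \<epsilon>"
proof -
  define a' where "a' = (a + a0) / 2"
  have a': "0 < a'" "a' < a0" "0 < a' - a" using a by (auto simp: a'_def)
  obtain d1 B where d1: "0 < d1" and B: "0 < B"
    and env: "\<And>f x. elc_density f \<Longrightarrow> (\<integral>x. \<bar>f x - f0 x\<bar> \<partial>lborel) \<le> d1 \<Longrightarrow> f x \<le> B * exp (- a' * \<bar>x\<bar>)"
    using L1_exp_envelope[OF f0 b a'(1,2)] by blast
  have env0: "f0 x \<le> B * exp (- a' * \<bar>x\<bar>)" for x using env[OF f0] d1 by simp
  obtain T0 where T0: "0 < T0" and tail: "B * exp (- (a' - a) * T0) \<le> \<epsilon>"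
    using exp_decay_small[OF a'(3) \<epsilon>] by blast
  define T where "T = (if A = \<infinity> then T0 else real_of_ereal A)"
  have T: "0 < T" and TA: "ereal T \<le> A" using T0 A by (cases A; simp add: T_def)+
  have "isCont f0 t" if "\<bar>t\<bar> \<le> T" for t
  proof (rule cont)
    have "ereal (- T) \<le> ereal t" "ereal t \<le> ereal T" using that by auto
    moreover have "- A \<le> ereal (- T)" using TA by (metis ereal_minus_le_minus uminus_ereal.simps(1))
    ultimately show "- A \<le> ereal t" "ereal t \<le> A" using TA order_trans by blast+
  qed
  then obtain d2 where d2: "0 < d2"
    and close: "\<And>f t. elc_density f \<Longrightarrow> (\<integral>x. \<bar>f x - f0 x\<bar> \<partial>lborel) \<le> d2 \<Longrightarrow> \<bar>t\<bar> \<le> T \<Longrightarrow> \<bar>f t - f0 t\<bar> \<le> \<epsilon> * exp (- a * T)"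
    using uniform_close[OF f0 T, of "\<epsilon> * exp (- a * T)"] \<epsilon> by auto
  have "exp (a * t) * \<bar>f t - f0 t\<bar> \<le> \<epsilon>"
    if f: "elc_density f" and D: "(\<integral>x. \<bar>f x - f0 x\<bar> \<partial>lborel) \<le> min d1 d2"
      and t: "- A \<le> ereal t" "ereal t \<le> A" for f t
  proof (cases "\<bar>t\<bar> \<le> T")
    case True
    have "exp (a * t) * \<bar>f t - f0 t\<bar> \<le> exp (a * T) * (\<epsilon> * exp (- a * T))"
      using close[OF f _ True] D True a by (intro mult_mono) auto
    also have "\<dots> = \<epsilon> * exp (a * T + - a * T)" unfolding exp_add by simp
    finally show ?thesis by simp
  next
    case False
    have "A = \<infinity>"
    proof (rule ccontr)
      assume "A \<noteq> \<infinity>"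
      then have "A = ereal T" using A by (cases A) (auto simp: T_def)
      then show False using t False by (auto simp: abs_le_iff)
    qed
    then have "T0 \<le> \<bar>t\<bar>" using False by (simp add: T_def)
    have "exp (a * t) * \<bar>f t - f0 t\<bar> \<le> B * exp (- (a' - a) * \<bar>t\<bar>)"
      using weighted_tail_le[OF f env[OF f] f0 env0 a(1)] D by simp
    also have "\<dots> \<le> B * exp (- (a' - a) * T0)"
      using B mult_left_mono[OF \<open>T0 \<le> \<bar>t\<bar>\<close>, of "a' - a"] a' by simp
    finally show ?thesis using tail by simp
  qed
  then have "(SUP t\<in>{t::real. - A \<le> ereal t \<and> ereal t \<le> A}. ennreal (exp (a * t) * \<bar>f t - f0 t\<bar>)) \<le> ennreal \<epsilon>"
    if "elc_density f" "(\<integral>x. \<bar>f x - f0 x\<bar> \<partial>lborel) \<le> min d1 d2" for f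
    using that by (intro SUP_least ennreal_leI) auto
  then show ?thesis using d1 d2 by (intro exI[of _ "min d1 d2"]) auto
qed

lemma hellinger_le_L1:
  assumes f: "elc_density f" and f0: "elc_density f0"
  shows "hellinger f f0 \<le> sqrt (\<integral>x. \<bar>f x - f0 x\<bar> \<partial>lborel)"
proof -
  note [measurable] = elc_measurable[OF elcd_elc[OF f]] elc_measurable[OF elcd_elc[OF f0]]
  note nn = elc_nonneg[OF elcd_elc[OF f]] elc_nonneg[OF elcd_elc[OF f0]]
  have "(sqrt a - sqrt b)\<^sup>2 \<le> \<bar>a - b\<bar>" if "0 \<le> a" "0 \<le> b" for a b :: real
  proof -
    have "(sqrt a - sqrt b)\<^sup>2 = \<bar>sqrt a - sqrt b\<bar> * \<bar>sqrt a - sqrt b\<bar>" by (simp add: power2_eq_square)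
    also have "\<dots> \<le> \<bar>sqrt a - sqrt b\<bar> * (sqrt a + sqrt b)"
      using real_sqrt_ge_zero[OF that(1)] real_sqrt_ge_zero[OF that(2)] by (intro mult_left_mono) linarith+
    also have "\<dots> = \<bar>(sqrt a - sqrt b) * (sqrt a + sqrt b)\<bar>" using that by (simp add: abs_mult)
    also have "(sqrt a - sqrt b) * (sqrt a + sqrt b) = a - b"
      using that by (simp add: algebra_simps flip: power2_eq_square)
    finally show ?thesis .
  qed
  then have pt: "(sqrt (f x) - sqrt (f0 x))\<^sup>2 \<le> \<bar>f x - f0 x\<bar>" for x using nn by simp
  have i: "integrable lborel (\<lambda>x. \<bar>f x - f0 x\<bar>)"
    using elcd_integrable[OF f] elcd_integrable[OF f0] by simp
  have "integrable lborel (\<lambda>x. (sqrt (f x) - sqrt (f0 x))\<^sup>2)"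
    by (rule Bochner_Integration.integrable_bound[OF i]) (use pt in auto)
  then have "(\<integral>x. (sqrt (f x) - sqrt (f0 x))\<^sup>2 \<partial>lborel) \<le> (\<integral>x. \<bar>f x - f0 x\<bar> \<partial>lborel)"
    using i pt by (intro integral_mono) auto
  moreover have "0 \<le> (\<integral>x. (sqrt (f x) - sqrt (f0 x))\<^sup>2 \<partial>lborel)" by (intro Bochner_Integration.integral_nonneg) auto
  ultimately show ?thesis unfolding hellinger_def by (intro real_sqrt_le_mono) linarith
qed

section \<open>Events of probability tending to one\<close>

text \<open>``With high probability''. The outer measure matches the one in \<open>op1\<close>.\<close>

definition whp :: "'w measure \<Rightarrow> (nat \<Rightarrow> 'w \<Rightarrow> bool) \<Rightarrow> bool" where
  "whp M P \<longleftrightarrow> (\<lambda>n. outer_measure_of M {\<omega> \<in> space M. \<not> P n \<omega>}) \<longlonglongrightarrow> 0"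

lemma op1_iff_whp: "op1 M Z \<longleftrightarrow> (\<forall>\<epsilon>>0. whp M (\<lambda>n \<omega>. Z n \<omega> \<le> ennreal \<epsilon>))"
  by (simp add: op1_def whp_def not_le)

lemma whp_mono:
  assumes "whp M P" and "\<forall>\<^sub>F n in sequentially. \<forall>\<omega>\<in>space M. P n \<omega> \<longrightarrow> Q n \<omega>"
  shows "whp M Q"
  unfolding whp_def
proof (rule tendsto_sandwich[OF _ _ tendsto_const assms(1)[unfolded whp_def]])
  show "\<forall>\<^sub>F n in sequentially. outer_measure_of M {\<omega> \<in> space M. \<not> Q n \<omega>} \<le> outer_measure_of M {\<omega> \<in> space M. \<not> P n \<omega>}"
    using assms(2) by eventually_elim (auto intro!: outer_measure_of_mono)
qed simp

lemma outer_measure_of_Un: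
  assumes "A \<subseteq> space M" "B \<subseteq> space M"
  shows "outer_measure_of M (A \<union> B) \<le> outer_measure_of M A + outer_measure_of M B"
proof -
  obtain E F where E: "E \<in> sets M" "A \<subseteq> E" "outer_measure_of M A = emeasure M E"
    and F: "F \<in> sets M" "B \<subseteq> F" "outer_measure_of M B = emeasure M F"
    using outer_measure_of_attain[OF assms(1)] outer_measure_of_attain[OF assms(2)] by auto
  have "outer_measure_of M (A \<union> B) \<le> outer_measure_of M (E \<union> F)"
    using E F by (intro outer_measure_of_mono) auto
  also have "\<dots> = emeasure M (E \<union> F)" using E F by simp
  also have "\<dots> \<le> emeasure M E + emeasure M F" using E F by (intro emeasure_subadditive)
  finally show ?thesis using E F by simp
qed

lemma whp_conj:
  assumes "whp M P" "whp M Q"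
  shows "whp M (\<lambda>n \<omega>. P n \<omega> \<and> Q n \<omega>)"
  unfolding whp_def
proof (rule tendsto_sandwich[OF _ _ tendsto_const])
  show "(\<lambda>n. outer_measure_of M {\<omega> \<in> space M. \<not> P n \<omega>} + outer_measure_of M {\<omega> \<in> space M. \<not> Q n \<omega>}) \<longlonglongrightarrow> 0"
    using tendsto_add[OF assms[unfolded whp_def]] by simp
  show "\<forall>\<^sub>F n in sequentially. outer_measure_of M {\<omega> \<in> space M. \<not> (P n \<omega> \<and> Q n \<omega>)}
      \<le> outer_measure_of M {\<omega> \<in> space M. \<not> P n \<omega>} + outer_measure_of M {\<omega> \<in> space M. \<not> Q n \<omega>}"
  proof (rule always_eventually, rule allI)
    fix n
    have "{\<omega> \<in> space M. \<not> (P n \<omega> \<and> Q n \<omega>)} = {\<omega> \<in> space M. \<not> P n \<omega>} \<union> {\<omega> \<in> space M. \<not> Q n \<omega>}"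
      by auto
    then show "outer_measure_of M {\<omega> \<in> space M. \<not> (P n \<omega> \<and> Q n \<omega>)}
      \<le> outer_measure_of M {\<omega> \<in> space M. \<not> P n \<omega>} + outer_measure_of M {\<omega> \<in> space M. \<not> Q n \<omega>}"
      using outer_measure_of_Un[of "{\<omega> \<in> space M. \<not> P n \<omega>}" M "{\<omega> \<in> space M. \<not> Q n \<omega>}"] by simp
  qed
qed simp

lemma whp_AE:
  assumes "\<forall>\<^sub>F n in sequentially. AE \<omega> in M. P n \<omega>"
  shows "whp M P"
  unfolding whp_def
proof (rule tendsto_eventually)
  show "\<forall>\<^sub>F n in sequentially. outer_measure_of M {\<omega> \<in> space M. \<not> P n \<omega>} = 0"
    using assms
  proof eventually_elim
    case (elim n)
    then obtain N where N: "{\<omega> \<in> space M. \<not> P n \<omega>} \<subseteq> N" "emeasure M N = 0" "N \<in> sets M"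
      by (rule AE_E)
    then have "outer_measure_of M {\<omega> \<in> space M. \<not> P n \<omega>} \<le> outer_measure_of M N"
      by (intro outer_measure_of_mono)
    then show ?case using N by simp
  qed
qed

lemma whp_ball:
  assumes "finite J" "\<And>j. j \<in> J \<Longrightarrow> whp M (P j)"
  shows "whp M (\<lambda>n \<omega>. \<forall>j\<in>J. P j n \<omega>)"
  using assms
proof (induction rule: finite_induct)
  case empty
  show ?case by (rule whp_AE) simp
next
  case (insert j J)
  then show ?case using whp_conj[of M "P j" "\<lambda>n \<omega>. \<forall>j\<in>J. P j n \<omega>"] by simp
qed

section \<open>The weak law of large numbers\<close>

text \<open>Chebyshev's inequality; the centred summands are pairwise orthogonal by independence.\<close>

lemma (in prob_space) weak_law_density:
  fixes X :: "nat \<Rightarrow> 'a \<Rightarrow> real" and g h :: "real \<Rightarrow> real"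
  assumes indep: "indep_vars (\<lambda>_. borel) X {1..}"
    and X: "\<And>i. 1 \<le> i \<Longrightarrow> distributed M lborel (X i) (\<lambda>x. ennreal (g x))"
    and g: "\<And>x. 0 \<le> g x" and [measurable]: "h \<in> borel_measurable borel"
    and int: "integrable lborel (\<lambda>x. g x * (h x)\<^sup>2)"
    and \<epsilon>: "0 < \<epsilon>"
  shows "whp M (\<lambda>n \<omega>. \<bar>(1 / real n) * (\<Sum>i=1..n. h (X i \<omega>)) - (\<integral>x. g x * h x \<partial>lborel)\<bar> < \<epsilon>)"
proof -
  define \<mu> where "\<mu> = (\<integral>x. g x * h x \<partial>lborel)"
  define Z where "Z i \<omega> = h (X i \<omega>) - \<mu>" for i \<omega>
  define s where "s = expectation (\<lambda>\<omega>. (Z 1 \<omega>)\<^sup>2)"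
  have rvX [measurable]: "random_variable borel (X i)" if "1 \<le> i" for i
    using X[OF that] by (auto dest: distributed_measurable)
  have rvZ: "random_variable borel (Z i)" if "1 \<le> i" for i
    using rvX[OF that] unfolding Z_def by measurable
  have h2: "integrable M (\<lambda>\<omega>. (h (X i \<omega>))\<^sup>2)" if "1 \<le> i" for i
    using distributed_integrable[OF X[OF that], of "\<lambda>x. (h x)\<^sup>2"] g int by simp
  have h1: "integrable M (\<lambda>\<omega>. h (X i \<omega>))" if "1 \<le> i" for i
  proof (rule square_integrable_imp_integrable)
    show "random_variable borel (\<lambda>\<omega>. h (X i \<omega>))" using rvX[OF that] by measurable
  qed (rule h2[OF that])
  have Eh: "expectation (\<lambda>\<omega>. h (X i \<omega>)) = \<mu>" if "1 \<le> i" for i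
    using distributed_integral[OF X[OF that], of h] g by (simp add: \<mu>_def)
  have Z1: "integrable M (Z i)" "expectation (Z i) = 0" if "1 \<le> i" for i
    using h1[OF that] Eh[OF that] unfolding Z_def by (simp_all add: prob_space)
  have Z2: "integrable M (\<lambda>\<omega>. Z i \<omega> * Z i \<omega>)" if "1 \<le> i" for i
    using h1[OF that] h2[OF that] unfolding Z_def by (simp add: algebra_simps power2_eq_square)
  have Zs: "expectation (\<lambda>\<omega>. Z i \<omega> * Z i \<omega>) = s" if "1 \<le> i" for i
    using distributed_integral[OF X[OF that], of "\<lambda>x. (h x - \<mu>)\<^sup>2"]
      distributed_integral[OF X[of 1], of "\<lambda>x. (h x - \<mu>)\<^sup>2"] g
    by (simp add: s_def Z_def power2_eq_square)
  have "indep_vars (\<lambda>_. borel) Z {1..}"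
    unfolding Z_def[abs_def] by (rule indep_vars_compose2[OF indep]) measurable
  then have Zij: "integrable M (\<lambda>\<omega>. Z i \<omega> * Z j \<omega>)" "expectation (\<lambda>\<omega>. Z i \<omega> * Z j \<omega>) = 0"
    if "1 \<le> i" "1 \<le> j" "i \<noteq> j" for i j
    using indep_vars_integrable[of "{i, j}" Z] indep_vars_lebesgue_integral[of "{i, j}" Z]
      indep_vars_subset[of "\<lambda>_. borel" Z "{1..}" "{i, j}"] Z1 that by auto
  have bound: "prob {\<omega> \<in> space M. \<epsilon> \<le> \<bar>(1 / real n) * (\<Sum>i=1..n. h (X i \<omega>)) - \<mu>\<bar>} \<le> s / \<epsilon>\<^sup>2 / real n"
    if n: "1 \<le> n" for n
  proof -
    let ?S = "\<lambda>\<omega>. \<Sum>i=1..n. Z i \<omega>"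
    have S2: "(?S \<omega>)\<^sup>2 = (\<Sum>i=1..n. \<Sum>j=1..n. Z i \<omega> * Z j \<omega>)" for \<omega>
      by (simp add: power2_eq_square sum_product)
    have int2: "integrable M (\<lambda>\<omega>. Z i \<omega> * Z j \<omega>)" if "i \<in> {1..n}" "j \<in> {1..n}" for i j
      using Z2 Zij that by (cases "i = j") auto
    have iS2: "integrable M (\<lambda>\<omega>. (?S \<omega>)\<^sup>2)"
      unfolding S2 using int2 by (intro Bochner_Integration.integrable_sum)
    have rvS: "random_variable borel ?S" using rvZ by (intro borel_measurable_sum) auto
    have ES: "expectation ?S = 0"
      using Z1 by (subst Bochner_Integration.integral_sum) auto
    have "expectation (\<lambda>\<omega>. (?S \<omega>)\<^sup>2) = (\<Sum>i=1..n. \<Sum>j=1..n. expectation (\<lambda>\<omega>. Z i \<omega> * Z j \<omega>))"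
    proof -
      have "expectation (\<lambda>\<omega>. \<Sum>i=1..n. \<Sum>j=1..n. Z i \<omega> * Z j \<omega>)
          = (\<Sum>i=1..n. expectation (\<lambda>\<omega>. \<Sum>j=1..n. Z i \<omega> * Z j \<omega>))"
        by (rule Bochner_Integration.integral_sum, rule Bochner_Integration.integrable_sum, rule int2)
      also have "\<dots> = (\<Sum>i=1..n. \<Sum>j=1..n. expectation (\<lambda>\<omega>. Z i \<omega> * Z j \<omega>))"
        by (rule sum.cong[OF refl], rule Bochner_Integration.integral_sum, rule int2)
      finally show ?thesis unfolding S2 .
    qed
    also have "\<dots> = (\<Sum>i=1..n. \<Sum>j=1..n. if i = j then s else 0)"
      using Zs Zij by (intro sum.cong refl) auto
    also have "\<dots> = real n * s" by (simp add: sum.delta)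
    finally have V: "expectation (\<lambda>\<omega>. (?S \<omega>)\<^sup>2) = real n * s" .
    have "prob {\<omega> \<in> space M. real n * \<epsilon> \<le> \<bar>?S \<omega> - expectation ?S\<bar>} \<le> variance ?S / (real n * \<epsilon>)\<^sup>2"
      using n \<epsilon> by (intro Chebyshev_inequality rvS iS2) simp
    also have "variance ?S / (real n * \<epsilon>)\<^sup>2 = s / \<epsilon>\<^sup>2 / real n"
      using n \<epsilon> unfolding ES diff_0_right V by (simp add: power2_eq_square field_simps)
    also have "{\<omega> \<in> space M. real n * \<epsilon> \<le> \<bar>?S \<omega> - expectation ?S\<bar>}
        = {\<omega> \<in> space M. \<epsilon> \<le> \<bar>(1 / real n) * (\<Sum>i=1..n. h (X i \<omega>)) - \<mu>\<bar>}"
    proof (intro Collect_cong conj_cong refl)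
      fix \<omega>
      have "?S \<omega> = (\<Sum>i=1..n. h (X i \<omega>)) - real n * \<mu>" by (simp add: Z_def sum_subtractf)
      also have "\<dots> = real n * ((1 / real n) * (\<Sum>i=1..n. h (X i \<omega>)) - \<mu>)" using n by (simp add: right_diff_distrib)
      finally have "\<bar>?S \<omega> - expectation ?S\<bar> = real n * \<bar>(1 / real n) * (\<Sum>i=1..n. h (X i \<omega>)) - \<mu>\<bar>"
        using n unfolding ES by (simp only: abs_mult diff_0_right abs_of_nat)
      then show "real n * \<epsilon> \<le> \<bar>?S \<omega> - expectation ?S\<bar> \<longleftrightarrow> \<epsilon> \<le> \<bar>(1 / real n) * (\<Sum>i=1..n. h (X i \<omega>)) - \<mu>\<bar>"
        using n by simp
    qed
    finally show ?thesis .
  qed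
  have meas: "{\<omega> \<in> space M. \<epsilon> \<le> \<bar>(1 / real n) * (\<Sum>i=1..n. h (X i \<omega>)) - \<mu>\<bar>} \<in> events" for n
    by measurable
  have lim: "(\<lambda>n. ennreal (s / \<epsilon>\<^sup>2 / real n)) \<longlonglongrightarrow> ennreal 0"
    by (intro tendsto_ennrealI lim_const_over_n)
  show ?thesis
    unfolding whp_def \<mu>_def[symmetric] not_less
  proof (rule tendsto_sandwich[OF _ _ tendsto_const])
    show "(\<lambda>n. ennreal (s / \<epsilon>\<^sup>2 / real n)) \<longlonglongrightarrow> 0" using lim by simp
    show "\<forall>\<^sub>F n in sequentially. outer_measure_of M {\<omega> \<in> space M. \<epsilon> \<le> \<bar>(1 / real n) * (\<Sum>i=1..n. h (X i \<omega>)) - \<mu>\<bar>}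
        \<le> ennreal (s / \<epsilon>\<^sup>2 / real n)"
      using eventually_ge_at_top[of 1]
      by eventually_elim (use bound meas in \<open>auto simp: emeasure_eq_measure intro!: ennreal_leI\<close>)
  qed simp
qed

section \<open>Consistency of the maximum likelihood estimator\<close>

lemma consistent_whp:
  assumes "consistent M T \<theta>" "0 < d"
  shows "whp M (\<lambda>n \<omega>. \<bar>T n \<omega> - \<theta>\<bar> \<le> d)"
  using assms unfolding consistent_def op1_iff_whp by simp

text \<open>The Kolmogorov distance between the empirical measure and the true law tends to \<open>0\<close> in
  probability: the weak law at finitely many quantiles suffices.\<close>

lemma (in prob_space) whp_lower_close:
  fixes X :: "nat \<Rightarrow> 'a \<Rightarrow> real"
  assumes indep: "indep_vars (\<lambda>_. borel) X {1..}"
    and X: "\<And>i. 1 \<le> i \<Longrightarrow> distributed M lborel (X i) (\<lambda>x. ennreal (g x))"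
    and g: "\<And>x. 0 \<le> g x" "integrable lborel g" "integral\<^sup>L lborel g = 1" and d: "0 < d"
  shows "whp M (\<lambda>n \<omega>. lower_close d (empirical n (sample X n \<omega>)) (density lborel (\<lambda>x. ennreal (g x))))"
proof -
  let ?G = "density lborel (\<lambda>x. ennreal (g x))"
  have [measurable]: "g \<in> borel_measurable borel" using g(2) by auto
  interpret G: prob_space ?G
    by standard (use g in \<open>simp add: emeasure_density nn_integral_eq_integral\<close>)
  interpret G: real_distribution ?G by standard simp
  have atomless: "measure ?G {x} = 0" for x
  proof -
    have "AE y in lborel. ennreal (g y) * indicator {x} y = 0"
      using AE_lborel_singleton[of x] by eventually_elim simp
    then have "emeasure ?G {x} = 0"
      by (simp add: emeasure_density nn_integral_0_iff_AE)
    then show ?thesis by (simp add: measure_def)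
  qed
  obtain m :: nat where m: "2 / d < real m" using reals_Archimedean2 by blast
  then have m0: "0 < real m" using d by (meson divide_pos_pos less_trans zero_less_numeral)
  have md: "1 / real m \<le> d / 2" using m m0 d by (simp add: field_simps)
  obtain t where t: "\<And>j. j \<in> {1..<m} \<Longrightarrow> measure ?G {..t j} = real j / real m"
    using quantile_grid[OF G.real_distribution_axioms atomless, of m] by blast
  have int: "integrable lborel (\<lambda>x. g x * (indicator {..t j} x)\<^sup>2)" for j
    by (rule Bochner_Integration.integrable_bound[OF g(2)]) (use g(1) in \<open>auto simp: indicator_def\<close>)
  have eq: "(\<integral>x. g x * indicator {..t j} x \<partial>lborel) = measure ?G {..t j}" for j
  proof -
    have "(\<integral>x. g x * indicator {..t j} x \<partial>lborel) = integral\<^sup>L ?G (indicator {..t j})"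
      using g(1) by (subst integral_density) auto
    then show ?thesis by simp
  qed
  have "whp M (\<lambda>n \<omega>. \<bar>(1 / real n) * (\<Sum>i=1..n. indicator {..t j} (X i \<omega>)) - measure ?G {..t j}\<bar> < d / 2)" for j
    using weak_law_density[OF indep X g(1) _ int[of j], of "d / 2"] d unfolding eq by simp
  then have "whp M (\<lambda>n \<omega>. \<forall>j\<in>{1..<m}. \<bar>(1 / real n) * (\<Sum>i=1..n. indicator {..t j} (X i \<omega>)) - measure ?G {..t j}\<bar> < d / 2)"
    by (intro whp_ball) auto
  then show ?thesis
  proof (rule whp_mono)
    show "\<forall>\<^sub>F n in sequentially. \<forall>\<omega>\<in>space M.
        (\<forall>j\<in>{1..<m}. \<bar>(1 / real n) * (\<Sum>i=1..n. indicator {..t j} (X i \<omega>)) - measure ?G {..t j}\<bar> < d / 2)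
        \<longrightarrow> lower_close d (empirical n (sample X n \<omega>)) ?G"
      using eventually_ge_at_top[of 1]
    proof (eventually_elim, intro ballI impI)
      fix n \<omega>
      assume n: "1 \<le> n" and
        *: "\<forall>j\<in>{1..<m}. \<bar>(1 / real n) * (\<Sum>i=1..n. indicator {..t j} (X i \<omega>)) - measure ?G {..t j}\<bar> < d / 2"
      have me: "measure (empirical n (sample X n \<omega>)) {..t j} = (1 / real n) * (\<Sum>i=1..n. indicator {..t j} (X i \<omega>))" for j
        by (subst measure_empirical[OF n]) (simp_all add: sample_def)
      have "lower_close (1 / real m + d / 2) (empirical n (sample X n \<omega>)) ?G"
        using m0 t * d
        by (intro lower_close_grid[where t = t] prob_space_empirical G.prob_space_axioms)
           (auto simp: me less_imp_le)
      then show "lower_close d (empirical n (sample X n \<omega>)) ?G"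
        using md unfolding lower_close_def by fastforce
    qed
  qed
qed

text \<open>With probability tending to one the sample satisfies \<open>near_truth\<close>, and then the deterministic
  statement applies to whatever maximizer has been chosen.\<close>

lemma (in prob_space) whp_maximizer_close:
  fixes X :: "nat \<Rightarrow> 'a \<Rightarrow> real"
  assumes f0: "f0 \<in> SLC1" and p0: "p0 \<in> {0<..<1} - {1/2}"
    and indep: "indep_vars (\<lambda>_. borel) X {1..}"
    and X: "\<And>i. 1 \<le> i \<Longrightarrow> distributed M lborel (X i) (\<lambda>x. ennreal (mixture p0 v1 v2 f0 x))"
    and cons: "consistent M p p0" "consistent M u1 v1" "consistent M u2 v2"
    and max: "\<forall>\<^sub>F n in sequentially. AE \<omega> in M.
      is_arg_max (Phi n (sample X n \<omega>) (p n \<omega>) (u1 n \<omega>) (u2 n \<omega>)) (\<lambda>\<psi>. \<psi> \<in> SC) (\<psi> n \<omega>)"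
    and \<epsilon>: "0 < \<epsilon>"
  shows "whp M (\<lambda>n \<omega>. elc_density (\<lambda>y. exp_ext (\<psi> n \<omega> y))
    \<and> (\<integral>y. \<bar>exp_ext (\<psi> n \<omega> y) - f0 y\<bar> \<partial>lborel) \<le> \<epsilon>)"
proof -
  obtain \<psi>0 where \<psi>0: "\<psi>0 \<in> SC" "f0 = (\<lambda>y. exp_ext (\<psi>0 y))"
    using f0 by (auto simp: SLC1_def SLC_def)
  have e0: "elc_density f0"
    using f0 even_logconcave_exp_ext[OF \<psi>0(1)] \<psi>0(2) by (simp add: elc_density_def SLC1_def)
  have p: "0 < p0" "p0 < 1" "p0 \<noteq> 1 / 2" and pp: "0 \<le> p0" "p0 \<le> 1" using p0 by auto
  define g0 where "g0 = mixture p0 v1 v2 f0"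
  note g0 = mixture_nonneg[OF e0 pp, of v1 v2, folded g0_def] mixture_integrable[OF e0 pp, of v1 v2, folded g0_def]
    mixture_integral[OF e0 pp, of v1 v2, folded g0_def]
  have [measurable]: "g0 \<in> borel_measurable borel" unfolding g0_def by (rule mixture_measurable[OF e0 pp])
  have Xg: "1 \<le> i \<Longrightarrow> distributed M lborel (X i) (\<lambda>x. ennreal (g0 x))" for i using X by (simp add: g0_def)
  let ?E = "\<integral>y. g0 y * ln (g0 y) \<partial>lborel"
  obtain d where d: "0 < d" and close: "\<forall>n\<ge>1. \<forall>x p u1 u2 \<psi>. near_truth d p0 v1 v2 g0 n x p u1 u2 \<longrightarrow>
      is_arg_max (Phi n x p u1 u2) (\<lambda>\<psi>. \<psi> \<in> SC) \<psi> \<longrightarrow>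
      elc_density (\<lambda>y. exp_ext (\<psi> y)) \<and> (\<integral>y. \<bar>exp_ext (\<psi> y) - f0 y\<bar> \<partial>lborel) \<le> \<epsilon>"
    using maximizer_L1_close[OF \<psi>0 e0 p \<epsilon>, of v1 v2] unfolding g0_def[symmetric] by (elim exE conjE)
  have pos: "whp M (\<lambda>n \<omega>. \<forall>i\<in>{1..n}. 0 < g0 (X i \<omega>))"
  proof (rule whp_AE, rule always_eventually, rule allI)
    fix n
    have "AE \<omega> in M. 0 < g0 (X i \<omega>)" if "1 \<le> i" for i
      by (subst distributed_AE2[OF Xg[OF that]]) auto
    then have "AE \<omega> in M. i \<in> {1..n} \<longrightarrow> 0 < g0 (X i \<omega>)" for i by auto
    then show "AE \<omega> in M. \<forall>i\<in>{1..n}. 0 < g0 (X i \<omega>)"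
      unfolding Ball_def by (simp only: AE_all_countable) simp
  qed
  have lik: "whp M (\<lambda>n \<omega>. \<bar>(1 / real n) * (\<Sum>i=1..n. ln (g0 (X i \<omega>))) - ?E\<bar> < d)"
    using mixture_ln2_integrable[OF e0 pp, of v1 v2] d
    by (intro weak_law_density[OF indep Xg g0(1)]) (auto simp: g0_def[symmetric])
  note low = whp_lower_close[OF indep Xg g0 d]
  note c = cons[THEN consistent_whp, OF d]
  have "whp M (\<lambda>n \<omega>. (\<bar>p n \<omega> - p0\<bar> \<le> d \<and> \<bar>u1 n \<omega> - v1\<bar> \<le> d \<and> \<bar>u2 n \<omega> - v2\<bar> \<le> d) \<and>
      lower_close d (empirical n (sample X n \<omega>)) (density lborel (\<lambda>y. ennreal (g0 y))) \<and>
      (\<forall>i\<in>{1..n}. 0 < g0 (X i \<omega>)) \<and> \<bar>(1 / real n) * (\<Sum>i=1..n. ln (g0 (X i \<omega>))) - ?E\<bar> < d)"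
    by (rule whp_conj[OF whp_conj[OF c(1) whp_conj[OF c(2,3)]] whp_conj[OF low whp_conj[OF pos lik]]])
  then have "whp M (\<lambda>n \<omega>. near_truth d p0 v1 v2 g0 n (sample X n \<omega>) (p n \<omega>) (u1 n \<omega>) (u2 n \<omega>))"
  proof (rule whp_mono, intro always_eventually allI ballI impI, elim conjE)
    fix n \<omega>
    assume *: "\<bar>p n \<omega> - p0\<bar> \<le> d" "\<bar>u1 n \<omega> - v1\<bar> \<le> d" "\<bar>u2 n \<omega> - v2\<bar> \<le> d"
      "lower_close d (empirical n (sample X n \<omega>)) (density lborel (\<lambda>y. ennreal (g0 y)))"
      "\<forall>i\<in>{1..n}. 0 < g0 (X i \<omega>)" and L: "\<bar>(1 / real n) * (\<Sum>i=1..n. ln (g0 (X i \<omega>))) - ?E\<bar> < d"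
    have eq: "sample X n \<omega> i = X i \<omega>" if "i \<in> {1..n}" for i
      using that by (simp add: sample_def)
    have "(\<Sum>i=1..n. ln (g0 (sample X n \<omega> i))) = (\<Sum>i=1..n. ln (g0 (X i \<omega>)))"
      by (intro sum.cong refl) (simp only: eq)
    moreover have "?E - d \<le> (1 / real n) * (\<Sum>i=1..n. ln (g0 (X i \<omega>)))" using L unfolding abs_less_iff by linarith
    ultimately have "?E - d \<le> (1 / real n) * (\<Sum>i=1..n. ln (g0 (sample X n \<omega> i)))" by (simp only:)
    moreover have "\<forall>i\<in>{1..n}. 0 < g0 (sample X n \<omega> i)" using *(5) eq by metis
    ultimately show "near_truth d p0 v1 v2 g0 n (sample X n \<omega>) (p n \<omega>) (u1 n \<omega>) (u2 n \<omega>)"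
      unfolding near_truth_def by (intro conjI *(1-4))
  qed
  from whp_conj[OF this whp_AE[OF max]] show ?thesis
  proof (rule whp_mono)
    show "\<forall>\<^sub>F n in sequentially. \<forall>\<omega>\<in>space M.
      near_truth d p0 v1 v2 g0 n (sample X n \<omega>) (p n \<omega>) (u1 n \<omega>) (u2 n \<omega>) \<and>
      is_arg_max (Phi n (sample X n \<omega>) (p n \<omega>) (u1 n \<omega>) (u2 n \<omega>)) (\<lambda>\<psi>. \<psi> \<in> SC) (\<psi> n \<omega>) \<longrightarrow>
      elc_density (\<lambda>y. exp_ext (\<psi> n \<omega> y)) \<and> (\<integral>y. \<bar>exp_ext (\<psi> n \<omega> y) - f0 y\<bar> \<partial>lborel) \<le> \<epsilon>"
      using eventually_ge_at_top[of 1]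
    proof (eventually_elim, intro ballI impI, elim conjE)
      fix n \<omega>
      assume n: "1 \<le> n"
        and near: "near_truth d p0 v1 v2 g0 n (sample X n \<omega>) (p n \<omega>) (u1 n \<omega>) (u2 n \<omega>)"
        and max: "is_arg_max (Phi n (sample X n \<omega>) (p n \<omega>) (u1 n \<omega>) (u2 n \<omega>)) (\<lambda>\<psi>. \<psi> \<in> SC) (\<psi> n \<omega>)"
      show "elc_density (\<lambda>y. exp_ext (\<psi> n \<omega> y)) \<and> (\<integral>y. \<bar>exp_ext (\<psi> n \<omega> y) - f0 y\<bar> \<partial>lborel) \<le> \<epsilon>"
        by (rule close[rule_format, OF n near max])
    qed
  qed
qed

theorem corollary3p1:
  fixes M :: "'w measure"
    and X :: "nat \<Rightarrow> 'w \<Rightarrow> real"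
    and f0 :: "real \<Rightarrow> real"
    and \<pi>0 u10 u20 :: real
    and \<pi>c u1c u2c :: "nat \<Rightarrow> (nat \<Rightarrow> real) \<Rightarrow> real"
    and \<psi>hat :: "nat \<Rightarrow> 'w \<Rightarrow> real \<Rightarrow> ereal"
    and fhat :: "nat \<Rightarrow> 'w \<Rightarrow> real \<Rightarrow> real"
  assumes M: "prob_space M"
    and f0: "f0 \<in> SLC1"
    and \<pi>0: "\<pi>0 \<in> {0<..<1} - {1/2}"
    and u0: "u10 \<noteq> u20"
    and X_indep: "prob_space.indep_vars M (\<lambda>_. borel) X {1..}"
    and X_density: "\<And>i. i \<ge> 1 \<Longrightarrow>
          distributed M lborel (X i) (\<lambda>x. ennreal (mixture \<pi>0 u10 u20 f0 x))"
    and \<pi>c_meas: "\<And>n. n \<ge> 1 \<Longrightarrow> \<pi>c n \<in> borel_measurable (\<Pi>\<^sub>M i\<in>{1..n}. borel)"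
    and u1c_meas: "\<And>n. n \<ge> 1 \<Longrightarrow> u1c n \<in> borel_measurable (\<Pi>\<^sub>M i\<in>{1..n}. borel)"
    and u2c_meas: "\<And>n. n \<ge> 1 \<Longrightarrow> u2c n \<in> borel_measurable (\<Pi>\<^sub>M i\<in>{1..n}. borel)"
    and \<pi>c_range: "\<And>n \<omega>. n \<ge> 1 \<Longrightarrow> \<omega> \<in> space M \<Longrightarrow> \<pi>c n (sample X n \<omega>) \<in> {0<..<1} - {1/2}"
    and uc_less: "\<And>n \<omega>. n \<ge> 1 \<Longrightarrow> \<omega> \<in> space M \<Longrightarrow>
          u1c n (sample X n \<omega>) < u2c n (sample X n \<omega>)"
    and \<pi>c_consistent: "consistent M (\<lambda>n \<omega>. \<pi>c n (sample X n \<omega>)) \<pi>0"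
    and u1c_consistent: "consistent M (\<lambda>n \<omega>. u1c n (sample X n \<omega>)) u10"
    and u2c_consistent: "consistent M (\<lambda>n \<omega>. u2c n (sample X n \<omega>)) u20"
    and \<psi>hat: "\<forall>\<^sub>F n in sequentially. AE \<omega> in M.
          is_arg_max
            (Phi n (sample X n \<omega>)
              (\<pi>c n (sample X n \<omega>)) (u1c n (sample X n \<omega>)) (u2c n (sample X n \<omega>)))
            (\<lambda>\<psi>. \<psi> \<in> SC) (\<psi>hat n \<omega>)"
    and fhat: "\<And>n \<omega> x. fhat n \<omega> x = exp_ext (\<psi>hat n \<omega> x)"
  shows "op1 M (\<lambda>n \<omega>. ennreal (hellinger (fhat n \<omega>) f0)) \<and>
    (\<forall>a0>0. (\<exists>b. \<forall>x. f0 x \<le> exp (- a0 * x + b)) \<longrightarrow>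
      (\<forall>a\<in>{0<..<a0}.
        op1 M (\<lambda>n \<omega>. \<integral>\<^sup>+ t. ennreal (exp (a * t) * \<bar>fhat n \<omega> t - f0 t\<bar>) \<partial>lborel) \<and>
        (\<forall>A::ereal. 0 < A \<longrightarrow> (\<forall>t::real. - A \<le> ereal t \<and> ereal t \<le> A \<longrightarrow> isCont f0 t) \<longrightarrow>
          op1 M (\<lambda>n \<omega>. SUP t\<in>{t::real. - A \<le> ereal t \<and> ereal t \<le> A}.
                    ennreal (exp (a * t) * \<bar>fhat n \<omega> t - f0 t\<bar>)))))"
proof -
  interpret prob_space M by (rule M)
  have e0: "elc_density f0"
    using f0 even_logconcave_exp_ext by (auto simp: elc_density_def SLC1_def SLC_def)
  have fh: "fhat n \<omega> = (\<lambda>y. exp_ext (\<psi>hat n \<omega> y))" for n \<omega> using fhat by blast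
  \<comment> \<open>It suffices to bound a functional on the densities that are close to \<open>f0\<close> in \<open>L\<^sup>1\<close>.\<close>
  have op1I: "op1 M (\<lambda>n \<omega>. Z (fhat n \<omega>))"
    if Z: "\<And>\<epsilon>. 0 < \<epsilon> \<Longrightarrow> \<exists>d>0. \<forall>f. elc_density f \<longrightarrow> (\<integral>x. \<bar>f x - f0 x\<bar> \<partial>lborel) \<le> d \<longrightarrow> Z f \<le> ennreal \<epsilon>"
    for Z :: "(real \<Rightarrow> real) \<Rightarrow> ennreal"
    unfolding op1_iff_whp
  proof (intro allI impI)
    fix \<epsilon> :: real assume "0 < \<epsilon>"
    then obtain d where d: "0 < d"
      and close: "\<And>f. elc_density f \<Longrightarrow> (\<integral>x. \<bar>f x - f0 x\<bar> \<partial>lborel) \<le> d \<Longrightarrow> Z f \<le> ennreal \<epsilon>"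
      using Z by blast
    show "whp M (\<lambda>n \<omega>. Z (fhat n \<omega>) \<le> ennreal \<epsilon>)"
    proof (rule whp_mono)
      show "whp M (\<lambda>n \<omega>. elc_density (\<lambda>y. exp_ext (\<psi>hat n \<omega> y))
          \<and> (\<integral>y. \<bar>exp_ext (\<psi>hat n \<omega> y) - f0 y\<bar> \<partial>lborel) \<le> d)"
        by (rule whp_maximizer_close[OF f0 \<pi>0 X_indep X_density \<pi>c_consistent u1c_consistent u2c_consistent \<psi>hat d])
      show "\<forall>\<^sub>F n in sequentially. \<forall>\<omega>\<in>space M. elc_density (\<lambda>y. exp_ext (\<psi>hat n \<omega> y))
          \<and> (\<integral>y. \<bar>exp_ext (\<psi>hat n \<omega> y) - f0 y\<bar> \<partial>lborel) \<le> d \<longrightarrow> Z (fhat n \<omega>) \<le> ennreal \<epsilon>"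
        unfolding fh using close by (intro always_eventually allI ballI impI) blast
    qed
  qed
  have "op1 M (\<lambda>n \<omega>. ennreal (hellinger (fhat n \<omega>) f0))"
  proof (rule op1I)
    fix \<epsilon> :: real assume \<epsilon>: "0 < \<epsilon>"
    have "hellinger f f0 \<le> \<epsilon>" if f: "elc_density f" and D: "(\<integral>x. \<bar>f x - f0 x\<bar> \<partial>lborel) \<le> \<epsilon>\<^sup>2" for f
    proof -
      have "hellinger f f0 \<le> sqrt (\<epsilon>\<^sup>2)"
        using hellinger_le_L1[OF f e0] real_sqrt_le_mono[OF D] by linarith
      then show ?thesis using \<epsilon> by simp
    qed
    then show "\<exists>d>0. \<forall>f. elc_density f \<longrightarrow> (\<integral>x. \<bar>f x - f0 x\<bar> \<partial>lborel) \<le> d \<longrightarrow> ennreal (hellinger f f0) \<le> ennreal \<epsilon>"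
      using \<epsilon> by (intro exI[of _ "\<epsilon>\<^sup>2"]) (auto intro: ennreal_leI)
  qed
  moreover have "op1 M (\<lambda>n \<omega>. \<integral>\<^sup>+ t. ennreal (exp (a * t) * \<bar>fhat n \<omega> t - f0 t\<bar>) \<partial>lborel) \<and>
        (\<forall>A::ereal. 0 < A \<longrightarrow> (\<forall>t::real. - A \<le> ereal t \<and> ereal t \<le> A \<longrightarrow> isCont f0 t) \<longrightarrow>
          op1 M (\<lambda>n \<omega>. SUP t\<in>{t::real. - A \<le> ereal t \<and> ereal t \<le> A}.
                    ennreal (exp (a * t) * \<bar>fhat n \<omega> t - f0 t\<bar>)))"
    if b: "\<exists>b. \<forall>x. f0 x \<le> exp (- a0 * x + b)" and "a \<in> {0<..<a0}" for a0 a
  proof -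
    obtain b where b: "\<And>x. f0 x \<le> exp (- a0 * x + b)" using b by blast
    have a: "0 < a" "a < a0" using that(2) by auto
    show ?thesis
    proof (intro conjI allI impI)
      show "op1 M (\<lambda>n \<omega>. \<integral>\<^sup>+ t. ennreal (exp (a * t) * \<bar>fhat n \<omega> t - f0 t\<bar>) \<partial>lborel)"
        by (rule op1I) (rule weighted_L1_close[OF e0 b a])
      fix A :: ereal
      assume A: "0 < A" and cont: "\<forall>t::real. - A \<le> ereal t \<and> ereal t \<le> A \<longrightarrow> isCont f0 t"
      show "op1 M (\<lambda>n \<omega>. SUP t\<in>{t::real. - A \<le> ereal t \<and> ereal t \<le> A}.
                    ennreal (exp (a * t) * \<bar>fhat n \<omega> t - f0 t\<bar>))"
        by (rule op1I) (use cont in \<open>intro weighted_sup_close[OF e0 b a _ A]; blast\<close>)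
    qed
  qed
  ultimately show ?thesis by blast
qed

end
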